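(* Consider a sequential stochastic dynamic team $(\mathcal{P})$ with $N$ decision makers, cost function $c$ and a given information structure, and suppose that the absolute continuity condition holds: for every $i\in\mathcal{N}$ there exist a probability measure $Q^i$ on $\mathbb{Y}^i$ and a function $f^i$ such that for every Borel set $A^i$, $$P(y^i\in A^i\mid \omega_0,u^1,\dots,u^{i-1},y^1,\dots,y^{i-1})=\int_{A^i} f^i(y^i,\omega_0,u^1,\dots,u^{i-1},y^1,\dots,y^{i-1})\,Q^i(dy^i),$$ so that $(\mathcal{P})$ admits a policy-independent static reduction with reference measure $\mathbb{Q}$, Radon–Nikodym derivative $\frac{dP}{d\mathbb{Q}}=\prod_{i=1}^N f^i$ and reduced cost $\tilde c=c\,\frac{dP}{d\mathbb{Q}}$. Then: (i) A policy $\underline\gamma^*\in\Gamma$ is person-by-person (pbp) optimal (respectively, globally optimal) for $(\mathcal{P})$ if and only if $\underline\gamma^*$ is pbp optimal (respectively, globally optimal) for the policy-independent static reduction of $(\mathcal{P})$. (ii) Let $\underline\gamma^*$ satisfy, $P$-a.s., $$\nabla_{u^i}E_{\mathbb{Q}}^{\gamma^{-i*}}\Big[\tfrac{dP}{d\mathbb{Q}}\,\Big|\,y^i\Big]\Big|_{u^i=\gamma^{i*}(y^i)}=0\qquad\text{for all } i\in\mathcal{N}.$$ Then $\underline\gamma^*$ is stationary for $(\mathcal{P})$ if and only if $\underline\gamma^*$ is stationary for the policy-independent static reduction of $(\mathcal{P})$.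
   Context: Setting. $\mathcal{N}=\{1,\dots,N\}$; the decision makers DM$^1,\dots,$DM$^N$ act in this order, each once. Action spaces $\mathbb{U}^i\subseteq\mathbb{R}^{n_i}$ and observation spaces $\mathbb{Y}^i\subseteq\mathbb{R}^{m_i}$ are Borel. On a probability space $(\Omega,\mathcal{F},P)$ there are exogenous random variables $\omega_0$ (with values in a Borel space $\Omega_0$ and law $\mathbb{P}^0$) and $\omega_1,\dots,\omega_N$. Observations are $y^i=h^i(\omega_0,\omega_i,u^1,\dots,u^{i-1},y^1,\dots,y^{i-1})$ with $h^i$ measurable. The information of DM$^i$ is $I^i=\{y^i\}$ (or, more generally, $I^i=\{y^k\}_{k\in K_i}$ with $K_i\subseteq\{1,\dots,i\}$, in which case "$y^i$" as an argument of $\gamma^i$ or as a conditioning variable means $I^i$). $\Gamma^i$ is the set of measurable policies $\gamma^i$ with $u^i=\gamma^i(y^i)$, and $\Gamma=\prod_i\Gamma^i$. The cost is a Borel function $c:\Omega_0\times\prod_i\mathbb{U}^i\to\mathbb{R}_+$, and $J(\underline\gamma)=E_P^{\underline\gamma}[c(\omega_0,u^1,\dots,u^N)]$. Also denote by $P$ the joint law of $(\omega_0,u^1,\dots,u^N,y^1,\dots,y^N)$ (under a given policy). Policy-independent static reduction. The reference measure is $$\mathbb{Q}(d\omega_0,du^1,\dots,du^N,dy^1,\dots,dy^N)=\mathbb{P}^0(d\omega_0)\prod_{i=1}^N Q^i(dy^i)1_{\{\gamma^i(y^i)\in du^i\}},$$ and $\frac{dP}{d\mathbb{Q}}=\prod_{i=1}^N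 f^i(y^i,\omega_0,u^1,\dots,u^{i-1},y^1,\dots,y^{i-1})$. The reduced problem is the static team in which the measurements $y^i$ are independent with laws $Q^i$, with cost $\tilde c(\omega_0,u^1,\dots,u^N,y^1,\dots,y^N)=c(\omega_0,u^1,\dots,u^N)\frac{dP}{d\mathbb{Q}}$ and expected cost $E_{\mathbb{Q}}^{\underline\gamma}[\tilde c]$. Optimality concepts. For $(\mathcal{P})$, $\underline\gamma^*\in\Gamma$ is globally optimal if $J(\underline\gamma^* )=\inf_{\underline\gamma\in\Gamma}J(\underline\gamma)$; pbp optimal if $J(\underline\gamma^* )\le J(\underline\gamma^{-i*},\beta)$ for all $i$ and all $\beta\in\Gamma^i$, where $(\underline\gamma^{-i*},\beta)$ is $\underline\gamma^*$ with its $i$-th component replaced by $\beta$; stationary if for all $i$, $P$-a.s., $\nabla_{u^i}E_P[c(\omega_0,(\underline\gamma^{-i*}(y^{-i}),u^i))\mid y^i]|_{u^i=\gamma^{i*}(y^i)}=0$, where $(\underline\gamma^{-i*}(y^{-i}),u^i)$ is the action vector in which DM$^j$, $j\neq i$, uses $\gamma^{j*}(y^j)$ and DM$^i$ uses the action $u^i$ (the law $P$ of the observations being the one induced by these actions). For the reduction, globally optimal and pbp optimal are defined by the same formulas with $J(\underline\gamma)$ given by $E_{\mathbb{Q}}^{\underline\gamma}[\tilde c(\omega_0,u^1,\dots,u^N,y^1,\dots,y^N)]$; stationary means for all $i$, $P$-a.s., $\nabla_{u^i}E_{\mathbb{Q}}[\tilde c(\omega_0,(\underline\gamma^{-i*}(y^{-i}),u^i),y^1,\dots,y^N)\mid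 y^i]|_{u^i=\gamma^{i*}(y^i)}=0$. $E_{\mathbb{Q}}^{\gamma^{-i*}}[\cdot\mid y^i]$ denotes conditional expectation under $\mathbb{Q}$ when DM$^j$, $j\ne i$, use $\gamma^{j*}$ and DM$^i$ uses the action $u^i$. *)

theory Defs
  imports "HOL-Probability.Probability"
begin

section \<open>Sequential stochastic dynamic teams\<close>

text \<open>
  Sets of the form U \<subseteq> R^n with n depending on the decision maker are represented as Borel subsets
  of one Euclidean space 'u (resp. 'y), into which the finitely many R^n embed isometrically.
  Nothing below depends on the ambient space: Borel sets are taken relative to U, and derivatives
  are taken within U.  Likewise a Borel space is a Borel subset of a Polish space, and the noise
  spaces are arbitrary measurable spaces over a common carrier type.

  Families indexed by the decision makers are functions on nat; a family over an index set I is an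
  element of the extensional product PiM I.
\<close>

record ('p, 'a, 'w, 'u, 'y) team =
  num_DM :: nat
  prob_meas :: "'p measure"
  State :: "'a set"
  omega0 :: "'p \<Rightarrow> 'a"
  Noise :: "nat \<Rightarrow> 'w measure"
  omega :: "nat \<Rightarrow> 'p \<Rightarrow> 'w"
  Action :: "nat \<Rightarrow> 'u set"
  Observation :: "nat \<Rightarrow> 'y set"
  obs_fun :: "nat \<Rightarrow> 'a \<times> 'w \<times> (nat \<Rightarrow> 'u) \<times> (nat \<Rightarrow> 'y) \<Rightarrow> 'y"
  info_set :: "nat \<Rightarrow> nat set"
  cost :: "'a \<times> (nat \<Rightarrow> 'u) \<Rightarrow> real"

type_synonym ('u, 'y) policy = "nat \<Rightarrow> (nat \<Rightarrow> 'y) \<Rightarrow> 'u"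

definition state_space :: "('p, 'a::polish_space, 'w, 'u, 'y) team \<Rightarrow> 'a measure" where
  "state_space T = restrict_space borel (State T)"

definition act_space :: "('p, 'a, 'w, 'u::euclidean_space, 'y) team \<Rightarrow> nat \<Rightarrow> 'u measure" where
  "act_space T i = restrict_space borel (Action T i)"

definition obs_space :: "('p, 'a, 'w, 'u, 'y::euclidean_space) team \<Rightarrow> nat \<Rightarrow> 'y measure" where
  "obs_space T i = restrict_space borel (Observation T i)"

definition acts_space ::
  "('p, 'a, 'w, 'u::euclidean_space, 'y) team \<Rightarrow> nat set \<Rightarrow> (nat \<Rightarrow> 'u) measure" where
  "acts_space T I = PiM I (act_space T)"

definition obss_space ::
  "('p, 'a, 'w, 'u, 'y::euclidean_space) team \<Rightarrow> nat set \<Rightarrow> (nat \<Rightarrow> 'y) measure" where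
  "obss_space T I = PiM I (obs_space T)"

abbreviation DMs :: "('p, 'a, 'w, 'u, 'y) team \<Rightarrow> nat set" where
  "DMs T \<equiv> {1..num_DM T}"

text \<open>The noises are not assumed to be independent of each other or of omega0.\<close>

definition sequential_team ::
  "('p, 'a::polish_space, 'w, 'u::euclidean_space, 'y::euclidean_space) team \<Rightarrow> bool" where
  "sequential_team T \<longleftrightarrow>
     prob_space (prob_meas T) \<and>
     State T \<in> sets borel \<and>
     omega0 T \<in> measurable (prob_meas T) (state_space T) \<and>
     (\<forall>i\<in>DMs T.
        omega T i \<in> measurable (prob_meas T) (Noise T i) \<and>
        Action T i \<in> sets borel \<and>
        Observation T i \<in> sets borel \<and>
        obs_fun T i \<in> measurable
          (state_space T \<Otimes>\<^sub>M Noise T i \<Otimes>\<^sub>M acts_space T {1..<i} \<Otimes>\<^sub>M obss_space T {1..<i})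
          (obs_space T i) \<and>
        info_set T i \<subseteq> {1..i}) \<and>
     cost T \<in> borel_measurable (state_space T \<Otimes>\<^sub>M acts_space T (DMs T)) \<and>
     (\<forall>z\<in>space (state_space T \<Otimes>\<^sub>M acts_space T (DMs T)). 0 \<le> cost T z)"

definition DM_policies ::
  "('p, 'a, 'w, 'u::euclidean_space, 'y::euclidean_space) team \<Rightarrow> nat \<Rightarrow> ((nat \<Rightarrow> 'y) \<Rightarrow> 'u) set" where
  "DM_policies T i = measurable (obss_space T (info_set T i)) (act_space T i)"

definition policies ::
  "('p, 'a, 'w, 'u::euclidean_space, 'y::euclidean_space) team \<Rightarrow> ('u, 'y) policy set" where
  "policies T = Pi (DMs T) (DM_policies T)"

definition info :: "('p, 'a, 'w, 'u, 'y) team \<Rightarrow> nat \<Rightarrow> (nat \<Rightarrow> 'y) \<Rightarrow> (nat \<Rightarrow> 'y)" where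
  "info T i ys = restrict ys (info_set T i)"

definition actions ::
  "('p, 'a, 'w, 'u, 'y) team \<Rightarrow> ('u, 'y) policy \<Rightarrow> nat set \<Rightarrow> (nat \<Rightarrow> 'y) \<Rightarrow> (nat \<Rightarrow> 'u)" where
  "actions T \<gamma> I ys = (\<lambda>j\<in>I. \<gamma> j (info T j ys))"

primrec observations ::
  "('p, 'a, 'w, 'u, 'y) team \<Rightarrow> ('u, 'y) policy \<Rightarrow> 'p \<Rightarrow> nat \<Rightarrow> (nat \<Rightarrow> 'y)" where
  "observations T \<gamma> x 0 = (\<lambda>_. undefined)"
| "observations T \<gamma> x (Suc n) =
     (let ys = observations T \<gamma> x n
      in ys(Suc n := obs_fun T (Suc n)
             (omega0 T x, omega T (Suc n) x, actions T \<gamma> {1..<Suc n} ys, ys)))"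

definition outcome_space ::
  "('p, 'a::polish_space, 'w, 'u::euclidean_space, 'y::euclidean_space) team
     \<Rightarrow> ('a \<times> (nat \<Rightarrow> 'u) \<times> (nat \<Rightarrow> 'y)) measure" where
  "outcome_space T = state_space T \<Otimes>\<^sub>M acts_space T (DMs T) \<Otimes>\<^sub>M obss_space T (DMs T)"

definition joint_law ::
  "('p, 'a::polish_space, 'w, 'u::euclidean_space, 'y::euclidean_space) team
     \<Rightarrow> ('u, 'y) policy \<Rightarrow> ('a \<times> (nat \<Rightarrow> 'u) \<times> (nat \<Rightarrow> 'y)) measure" where
  "joint_law T \<gamma> = distr (prob_meas T) (outcome_space T)
     (\<lambda>x. let ys = observations T \<gamma> x (num_DM T)
          in (omega0 T x, actions T \<gamma> (DMs T) ys, ys))"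

section \<open>Absolute continuity and the policy-independent static reduction\<close>

type_synonym ('a, 'u, 'y) history = "'a \<times> (nat \<Rightarrow> 'u) \<times> (nat \<Rightarrow> 'y)"

definition history_space ::
  "('p, 'a::polish_space, 'w, 'u::euclidean_space, 'y::euclidean_space) team
     \<Rightarrow> nat \<Rightarrow> ('a, 'u, 'y) history measure" where
  "history_space T i = state_space T \<Otimes>\<^sub>M acts_space T {1..<i} \<Otimes>\<^sub>M obss_space T {1..<i}"

definition history ::
  "nat \<Rightarrow> 'a \<times> (nat \<Rightarrow> 'u) \<times> (nat \<Rightarrow> 'y) \<Rightarrow> ('a, 'u, 'y) history" where
  "history i = (\<lambda>(w, us, ys). (w, restrict us {1..<i}, restrict ys {1..<i}))"

text \<open>
  The conditional probability of y^i given the history is the conditional expectation of an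
  indicator under the joint law; Q and f do not depend on the policy, and the identity holds almost
  surely under every admissible policy.
\<close>

definition abs_continuity ::
  "('p, 'a::polish_space, 'w, 'u::euclidean_space, 'y::euclidean_space) team
     \<Rightarrow> (nat \<Rightarrow> 'y measure) \<Rightarrow> (nat \<Rightarrow> 'y \<times> ('a, 'u, 'y) history \<Rightarrow> real) \<Rightarrow> bool" where
  "abs_continuity T Q f \<longleftrightarrow>
     (\<forall>i\<in>DMs T.
        prob_space (Q i) \<and> sets (Q i) = sets (obs_space T i) \<and>
        f i \<in> borel_measurable (obs_space T i \<Otimes>\<^sub>M history_space T i) \<and>
        (\<forall>z\<in>space (obs_space T i \<Otimes>\<^sub>M history_space T i). 0 \<le> f i z) \<and>
        (\<forall>\<gamma>\<in>policies T. \<forall>A\<in>sets (obs_space T i).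
           AE z in joint_law T \<gamma>.
             nn_cond_exp (joint_law T \<gamma>)
               (vimage_algebra (space (outcome_space T)) (history i) (history_space T i))
               (indicator {(w, us, ys). ys i \<in> A}) z
             = (\<integral>\<^sup>+ y\<in>A. ennreal (f i (y, history i z)) \<partial>Q i)))"

definition ref_measure ::
  "('p, 'a::polish_space, 'w, 'u::euclidean_space, 'y::euclidean_space) team
     \<Rightarrow> (nat \<Rightarrow> 'y measure) \<Rightarrow> ('u, 'y) policy
     \<Rightarrow> ('a \<times> (nat \<Rightarrow> 'u) \<times> (nat \<Rightarrow> 'y)) measure" where
  "ref_measure T Q \<gamma> =
     distr (distr (prob_meas T) (state_space T) (omega0 T) \<Otimes>\<^sub>M PiM (DMs T) Q) (outcome_space T)
       (\<lambda>(w, ys). (w, actions T \<gamma> (DMs T) ys, ys))"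

definition dP_dQ ::
  "('p, 'a, 'w, 'u, 'y) team \<Rightarrow> (nat \<Rightarrow> 'y \<times> ('a, 'u, 'y) history \<Rightarrow> real)
     \<Rightarrow> 'a \<times> (nat \<Rightarrow> 'u) \<times> (nat \<Rightarrow> 'y) \<Rightarrow> real" where
  "dP_dQ T f z = (\<Prod>i\<in>DMs T. f i (snd (snd z) i, history i z))"

definition team_cost ::
  "('p, 'a, 'w, 'u, 'y) team \<Rightarrow> 'a \<times> (nat \<Rightarrow> 'u) \<times> (nat \<Rightarrow> 'y) \<Rightarrow> real" where
  "team_cost T = (\<lambda>(w, us, ys). cost T (w, us))"

definition reduced_cost ::
  "('p, 'a, 'w, 'u, 'y) team \<Rightarrow> (nat \<Rightarrow> 'y \<times> ('a, 'u, 'y) history \<Rightarrow> real)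
     \<Rightarrow> 'a \<times> (nat \<Rightarrow> 'u) \<times> (nat \<Rightarrow> 'y) \<Rightarrow> real" where
  "reduced_cost T f z = team_cost T z * dP_dQ T f z"

section \<open>Optimality and stationarity\<close>

text \<open>
  The argument M, which assigns to each policy a law on the outcome space, is the joint law for the
  original team and the reference measure for its reduction; \<phi> is the corresponding cost.
\<close>

definition exp_cost :: "(('u, 'y) policy \<Rightarrow> 'z measure) \<Rightarrow> ('z \<Rightarrow> real) \<Rightarrow> ('u, 'y) policy \<Rightarrow> ennreal" where
  "exp_cost M \<phi> \<gamma> = (\<integral>\<^sup>+ z. ennreal (\<phi> z) \<partial>M \<gamma>)"

definition globally_optimal ::
  "('p, 'a, 'w, 'u::euclidean_space, 'y::euclidean_space) team
     \<Rightarrow> (('u, 'y) policy \<Rightarrow> 'z measure) \<Rightarrow> ('z \<Rightarrow> real) \<Rightarrow> ('u, 'y) policy \<Rightarrow> bool" where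
  "globally_optimal T M \<phi> \<gamma> \<longleftrightarrow> exp_cost M \<phi> \<gamma> = (INF \<gamma>'\<in>policies T. exp_cost M \<phi> \<gamma>')"

definition pbp_optimal ::
  "('p, 'a, 'w, 'u::euclidean_space, 'y::euclidean_space) team
     \<Rightarrow> (('u, 'y) policy \<Rightarrow> 'z measure) \<Rightarrow> ('z \<Rightarrow> real) \<Rightarrow> ('u, 'y) policy \<Rightarrow> bool" where
  "pbp_optimal T M \<phi> \<gamma> \<longleftrightarrow>
     (\<forall>i\<in>DMs T. \<forall>\<beta>\<in>DM_policies T i. exp_cost M \<phi> \<gamma> \<le> exp_cost M \<phi> (\<gamma>(i := \<beta>)))"

text \<open>
  A version g (u, I^i) of the conditional expectation of \<phi> given I^i when the other decision makers
  use \<gamma> and decision maker i uses the action u.  For each fixed u the conditional expectation is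
  determined only up to a null set of values of I^i that may depend on u, which is not enough to
  speak of the gradient in u at u = \<gamma>^i(I^i): if the law of \<gamma>^i(I^i) has no atoms,
  changing g on the null sets {I^i. \<gamma>^i(I^i) = u} would already alter it.  Hence g is required to be jointly measurable and to give the conditional
  expectation also when u is chosen as a measurable function \<beta> of I^i (constant \<beta> being
  the case of a fixed action).  By measurable selection this determines g (u, I^i) simultaneously
  for all u, outside one null set of values of I^i.
\<close>

definition cond_exp_version ::
  "('p, 'a::polish_space, 'w, 'u::euclidean_space, 'y::euclidean_space) team
     \<Rightarrow> (('u, 'y) policy \<Rightarrow> ('a \<times> (nat \<Rightarrow> 'u) \<times> (nat \<Rightarrow> 'y)) measure)
     \<Rightarrow> ('a \<times> (nat \<Rightarrow> 'u) \<times> (nat \<Rightarrow> 'y) \<Rightarrow> real)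
     \<Rightarrow> ('u, 'y) policy \<Rightarrow> nat \<Rightarrow> ('u \<times> (nat \<Rightarrow> 'y) \<Rightarrow> ennreal) \<Rightarrow> bool" where
  "cond_exp_version T M \<phi> \<gamma> i g \<longleftrightarrow>
     g \<in> borel_measurable (act_space T i \<Otimes>\<^sub>M obss_space T (info_set T i)) \<and>
     (\<forall>\<beta>\<in>DM_policies T i.
        AE z in M (\<gamma>(i := \<beta>)).
          nn_cond_exp (M (\<gamma>(i := \<beta>)))
            (vimage_algebra (space (outcome_space T)) (\<lambda>(w, us, ys). info T i ys)
               (obss_space T (info_set T i)))
            (\<lambda>z. ennreal (\<phi> z)) z
          = g (\<beta> (info T i (snd (snd z))), info T i (snd (snd z))))"

text \<open>
  The gradient of an extended nonnegative function at u within U; it includes finiteness near u.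
  At interior points of U this is the ordinary gradient.
\<close>

definition has_gradient_within :: "('u::euclidean_space \<Rightarrow> ennreal) \<Rightarrow> 'u \<Rightarrow> 'u \<Rightarrow> 'u set \<Rightarrow> bool" where
  "has_gradient_within F D u U \<longleftrightarrow>
     F u < \<infinity> \<and> (\<forall>\<^sub>F v in at u within U. F v < \<infinity>) \<and>
     ((\<lambda>v. enn2real (F v)) has_derivative (\<lambda>h. D \<bullet> h)) (at u within U)"

text \<open>
  Vanishing of the gradient in u^i of the conditional expectation of \<phi> at u^i = \<gamma>^i(I^i), for
  all i.  The exceptional sets are null for the joint law P, also when M is the reference measure.
\<close>

definition cond_gradient_zero ::
  "('p, 'a::polish_space, 'w, 'u::euclidean_space, 'y::euclidean_space) team
     \<Rightarrow> (('u, 'y) policy \<Rightarrow> ('a \<times> (nat \<Rightarrow> 'u) \<times> (nat \<Rightarrow> 'y)) measure)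
     \<Rightarrow> ('a \<times> (nat \<Rightarrow> 'u) \<times> (nat \<Rightarrow> 'y) \<Rightarrow> real)
     \<Rightarrow> ('u, 'y) policy \<Rightarrow> bool" where
  "cond_gradient_zero T M \<phi> \<gamma> \<longleftrightarrow>
     (\<forall>i\<in>DMs T. \<exists>g. cond_exp_version T M \<phi> \<gamma> i g \<and>
        (AE z in joint_law T \<gamma>.
           has_gradient_within (\<lambda>u. g (u, info T i (snd (snd z)))) 0
             (\<gamma> i (info T i (snd (snd z)))) (Action T i)))"

definition stationary ::
  "('p, 'a::polish_space, 'w, 'u::euclidean_space, 'y::euclidean_space) team
     \<Rightarrow> (('u, 'y) policy \<Rightarrow> ('a \<times> (nat \<Rightarrow> 'u) \<times> (nat \<Rightarrow> 'y)) measure)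
     \<Rightarrow> ('a \<times> (nat \<Rightarrow> 'u) \<times> (nat \<Rightarrow> 'y) \<Rightarrow> real)
     \<Rightarrow> ('u, 'y) policy \<Rightarrow> bool" where
  "stationary T M \<phi> \<gamma> \<longleftrightarrow> cond_gradient_zero T M \<phi> \<gamma>"

end

theory Submission
  imports Defs
begin

text \<open>
  By induction on the stages, the joint law of the state and the first n observations has density
  f^1 \<cdots> f^n with respect to the product of the law of the state and Q^1, \<dots>, Q^n: the conditional
  law of y^(n+1) given the past is f^(n+1) Q^(n+1).  Pushing this forward to the outcomes gives
  P = (dP/dQ) Q under every policy.  Hence both problems assign the same expected cost to every
  policy, which settles optimality.

  For stationarity, Bayes' formula E_Q[c dP/dQ | I^i] = E_P[c | I^i] E_Q[dP/dQ | I^i] holds for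
  every choice of \<beta> as the policy of decision maker i, so products and quotients of versions of
  the conditional expectations are again versions.  The factor E_Q[dP/dQ | I^i] is P-almost surely
  nonzero and has vanishing gradient, so the product and quotient rules transfer a vanishing
  gradient from either side to the other.
\<close>

section \<open>Vanishing gradients\<close>

text \<open>Product rule: each of the two terms contains a vanishing derivative.
  \<open>enn2real\<close> is multiplicative on all extended values, so only finiteness needs a
  separate check.\<close>

lemma has_gradient_within_zero_mult:
  assumes "has_gradient_within F 0 u U" "has_gradient_within G 0 u U"
  shows "has_gradient_within (\<lambda>v. F v * G v) 0 u U"
  unfolding has_gradient_within_def
proof (intro conjI)
  show "F u * G u < \<infinity>"
    using assms by (simp add: has_gradient_within_def ennreal_mult_less_top)
  show "\<forall>\<^sub>F v in at u within U. F v * G v < \<infinity>"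
  proof -
    have "\<forall>\<^sub>F v in at u within U. F v < \<infinity>" "\<forall>\<^sub>F v in at u within U. G v < \<infinity>"
      using assms by (simp_all add: has_gradient_within_def)
    then show ?thesis
      by eventually_elim (simp add: ennreal_mult_less_top)
  qed
  have "((\<lambda>v. enn2real (F v)) has_derivative (\<lambda>h. 0 \<bullet> h)) (at u within U)"
    and "((\<lambda>v. enn2real (G v)) has_derivative (\<lambda>h. 0 \<bullet> h)) (at u within U)"
    using assms by (auto simp: has_gradient_within_def)
  from has_derivative_mult[OF this]
  show "((\<lambda>v. enn2real (F v * G v)) has_derivative (\<lambda>h. 0 \<bullet> h)) (at u within U)"
    by (simp add: enn2real_mult)
qed

text \<open>The conventions fit at the extremes. In \<open>ennreal\<close>, \<open>inverse 0\<close>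
  is infinite and is sent to 0, which is also the real \<open>inverse 0\<close>; at infinity both
  sides are 0 as well.\<close>

lemma enn2real_inverse: "enn2real (inverse x) = inverse (enn2real x)"
  by (cases x; cases "x = 0") (auto simp: inverse_ennreal)

lemma has_gradient_within_zero_inverse:
  assumes G: "has_gradient_within G 0 u U" and "G u \<noteq> 0"
  shows "has_gradient_within (\<lambda>v. inverse (G v)) 0 u U"
  unfolding has_gradient_within_def
proof (intro conjI)
  have der: "((\<lambda>v. enn2real (G v)) has_derivative (\<lambda>h. 0 \<bullet> h)) (at u within U)"
    and nz: "enn2real (G u) \<noteq> 0"
    using assms by (auto simp: has_gradient_within_def enn2real_eq_0_iff)
  show "inverse (G u) < \<infinity>"
    using \<open>G u \<noteq> 0\<close> by (simp add: less_top[symmetric])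
  \<comment> \<open>Differentiability gives continuity, so \<open>G\<close> stays nonzero near
    \<open>u\<close>; this is what keeps the inverse finite there.\<close>
  have "((\<lambda>v. enn2real (G v)) \<longlongrightarrow> enn2real (G u)) (at u within U)"
    using has_derivative_continuous[OF der] by (simp add: continuous_within)
  then have "\<forall>\<^sub>F v in at u within U. enn2real (G v) \<noteq> 0"
    using nz by (rule tendsto_imp_eventually_ne)
  then show "\<forall>\<^sub>F v in at u within U. inverse (G v) < \<infinity>"
    by eventually_elim (auto simp: less_top[symmetric] enn2real_eq_0_iff)
  show "((\<lambda>v. enn2real (inverse (G v))) has_derivative (\<lambda>h. 0 \<bullet> h)) (at u within U)"
    using Deriv.has_derivative_inverse[OF nz der] by (simp add: enn2real_inverse)
qed

section \<open>Conditional expectations under a change of measure\<close>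

lemma subalgebra_vimage_algebra:
  "h \<in> measurable M N \<Longrightarrow> subalgebra M (vimage_algebra (space M) h N)"
  unfolding subalgebra_def by (simp add: sets_image_in_sets)

text \<open>Abstract form of the reduction: \<open>M\<close> stands for the reference measure,
  \<open>density M D\<close> for the joint law, and \<open>F\<close> for the information of one
  decision maker. Finiteness of both measures makes conditional expectations given \<open>F\<close>
  available under each of them.\<close>

locale density_subalgebra =
  fixes M F :: "'z measure" and D :: "'z \<Rightarrow> ennreal"
  assumes finite_M: "finite_measure M"
    and finite_density: "finite_measure (density M D)"
    and sub: "subalgebra M F"
    and D_measurable [measurable]: "D \<in> borel_measurable M"
begin

sublocale M: finite_measure_subalgebra M F
  using finite_M sub by (simp add: finite_measure_subalgebra_def finite_measure_subalgebra_axioms_def)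

sublocale D: finite_measure_subalgebra "density M D" F
  using finite_density sub
  by (simp add: finite_measure_subalgebra_def finite_measure_subalgebra_axioms_def subalgebra_def)

lemma measurable_from_F: "g \<in> measurable F N \<Longrightarrow> g \<in> measurable M N"
  using sub by (rule measurable_from_subalg)

text \<open>The averaging property of \<open>nn_cond_exp M F D\<close>: restricted to
  \<open>F\<close>, the measure \<open>density M D\<close> has this conditional expectation as its
  density with respect to \<open>M\<close>.\<close>

lemma nn_integral_density_F:
  assumes g: "g \<in> borel_measurable F"
  shows "(\<integral>\<^sup>+x. g x \<partial>density M D) = (\<integral>\<^sup>+x. g x * nn_cond_exp M F D x \<partial>M)"
  using M.nn_cond_exp_intg[OF g D_measurable] measurable_from_F[OF g]
  by (simp add: nn_integral_density mult.commute)

text \<open>Bayes' formula without division. In this form it holds \<open>M\<close>-almost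
  everywhere, although the first factor on the right is determined only up to null sets of
  \<open>density M D\<close>: where it is ambiguous, the second factor vanishes.\<close>

lemma nn_cond_exp_times_density:
  assumes [measurable]: "\<phi> \<in> borel_measurable M"
  shows "AE x in M. nn_cond_exp M F (\<lambda>x. \<phi> x * D x) x =
    nn_cond_exp (density M D) F \<phi> x * nn_cond_exp M F D x"
proof -
  have [measurable]: "nn_cond_exp (density M D) F \<phi> \<in> borel_measurable M"
    by (rule measurable_from_F) simp
  \<comment> \<open>The product is measurable for \<open>F\<close>, so it is enough to compare
    integrals over sets of \<open>F\<close>. The integral is moved to \<open>density M D\<close>,
    conditioned there, and moved back by \<open>nn_integral_density_F\<close>.\<close>
  have "AE x in M. nn_cond_exp (density M D) F \<phi> x * nn_cond_exp M F D x =
    nn_cond_exp M F (\<lambda>x. \<phi> x * D x) x"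
  proof (rule M.nn_cond_exp_charact)
    fix A assume A [measurable]: "A \<in> sets F"
    then have [measurable]: "A \<in> sets M" using sub by (auto simp: subalgebra_def)
    have "(\<integral>\<^sup>+x\<in>A. (\<phi> x * D x) \<partial>M) = (\<integral>\<^sup>+x. indicator A x * \<phi> x \<partial>density M D)"
      by (simp add: nn_integral_density ac_simps)
    also have "\<dots> = (\<integral>\<^sup>+x. indicator A x * nn_cond_exp (density M D) F \<phi> x \<partial>density M D)"
      by (rule D.nn_cond_exp_intg[symmetric]) auto
    also have "\<dots> = (\<integral>\<^sup>+x\<in>A. (nn_cond_exp (density M D) F \<phi> x * nn_cond_exp M F D x) \<partial>M)"
      by (subst nn_integral_density_F) (auto simp: ac_simps)
    finally show "(\<integral>\<^sup>+x\<in>A. (\<phi> x * D x) \<partial>M) = \<dots>" .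
  qed auto
  then show ?thesis by (simp add: eq_commute)
qed

text \<open>Integrate the indicator \<open>g\<close> of the failure of \<open>P\<close>: by
  \<open>nn_integral_density_F\<close> it is null exactly when \<open>g\<close> times the
  conditional density vanishes almost everywhere. This carries statements about the information from
  the joint law back to the reference measure.\<close>

lemma AE_density_F:
  assumes P: "Measurable.pred F P"
  shows "(AE x in density M D. P x) \<longleftrightarrow> (AE x in M. nn_cond_exp M F D x \<noteq> 0 \<longrightarrow> P x)"
proof -
  define g :: "'z \<Rightarrow> ennreal" where "g x = (if P x then 0 else 1)" for x
  have g: "g \<in> borel_measurable F"
    unfolding g_def using P by measurable
  have [measurable]: "g \<in> borel_measurable M" by (rule measurable_from_F[OF g])
  have "(AE x in density M D. P x) \<longleftrightarrow> (AE x in density M D. g x = 0)"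
    by (simp add: g_def)
  also have "\<dots> \<longleftrightarrow> (\<integral>\<^sup>+x. g x \<partial>density M D) = 0"
    by (rule nn_integral_0_iff_AE[symmetric]) simp
  also have "\<dots> \<longleftrightarrow> (AE x in M. g x * nn_cond_exp M F D x = 0)"
    by (simp add: nn_integral_density_F[OF g] nn_integral_0_iff_AE)
  also have "\<dots> \<longleftrightarrow> (AE x in M. nn_cond_exp M F D x \<noteq> 0 \<longrightarrow> P x)"
    by (rule AE_cong) (auto simp: g_def)
  finally show ?thesis .
qed

lemma AE_density_of_AE: "AE x in M. P x \<Longrightarrow> AE x in density M D. P x"
  by (auto simp: AE_density)

text \<open>By \<open>AE_density_F\<close> the claim becomes a tautology about the conditional
  density.\<close>

lemma nn_cond_exp_density_nonzero: "AE x in density M D. nn_cond_exp M F D x \<noteq> 0"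
  by (subst AE_density_F) auto

text \<open>The integral of the conditional density is the total mass of \<open>density M D\<close>,
  which is finite.\<close>

lemma nn_cond_exp_density_finite: "AE x in M. nn_cond_exp M F D x \<noteq> \<infinity>"
proof (rule nn_integral_PInf_AE)
  show "(\<integral>\<^sup>+x. nn_cond_exp M F D x \<partial>M) \<noteq> \<infinity>"
    using nn_integral_density_F[of "\<lambda>_. 1"] D.finite_emeasure_space by simp
qed simp

text \<open>Bayes' formula may be divided by the conditional density because this is neither zero
  nor infinite almost everywhere under \<open>density M D\<close>; both exclusions are needed for
  cancellation in \<open>ennreal\<close>.\<close>

lemma nn_cond_exp_density_quotient:
  assumes "\<phi> \<in> borel_measurable M"
  shows "AE x in density M D. nn_cond_exp (density M D) F \<phi> x =
    nn_cond_exp M F (\<lambda>x. \<phi> x * D x) x * inverse (nn_cond_exp M F D x)"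
  using AE_density_of_AE[OF nn_cond_exp_times_density[OF assms]]
    AE_density_of_AE[OF nn_cond_exp_density_finite] nn_cond_exp_density_nonzero
proof eventually_elim
  case (elim x)
  then show ?case
    by (cases "nn_cond_exp M F D x")
      (auto simp: mult.assoc inverse_ennreal less_le simp flip: ennreal_mult)
qed

end

section \<open>The law of the observations\<close>

locale reducible_team =
  fixes T :: "('p, 'a::polish_space, 'w, 'u::euclidean_space, 'y::euclidean_space) team"
    and Q :: "nat \<Rightarrow> 'y measure"
    and f :: "nat \<Rightarrow> 'y \<times> ('a, 'u, 'y) history \<Rightarrow> real"
  assumes sequential: "sequential_team T"
    and abs_cont: "abs_continuity T Q f"
begin

section \<open>Basic consequences of the assumptions, causality and measurability\<close>

lemma prob_meas_prob_space: "prob_space (prob_meas T)"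
  using sequential by (simp add: sequential_team_def)

lemma omega0_measurable [measurable]: "omega0 T \<in> measurable (prob_meas T) (state_space T)"
  using sequential by (simp add: sequential_team_def)

lemma info_set_subset: "i \<in> DMs T \<Longrightarrow> info_set T i \<subseteq> {1..i}"
  using sequential by (simp add: sequential_team_def)

lemma Q_prob_space: "i \<in> DMs T \<Longrightarrow> prob_space (Q i)"
  using abs_cont by (simp add: abs_continuity_def)

lemma sets_Q: "i \<in> DMs T \<Longrightarrow> sets (Q i) = sets (obs_space T i)"
  using abs_cont by (simp add: abs_continuity_def)

lemma sets_PiM_Q: "I \<subseteq> DMs T \<Longrightarrow> sets (PiM I Q) = sets (obss_space T I)"
  unfolding obss_space_def by (rule sets_PiM_cong[OF refl], rule sets_Q) blast

lemma f_measurable: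
  "i \<in> DMs T \<Longrightarrow> f i \<in> borel_measurable (obs_space T i \<Otimes>\<^sub>M history_space T i)"
  using abs_cont by (simp add: abs_continuity_def)

lemma f_nonneg:
  "i \<in> DMs T \<Longrightarrow> z \<in> space (obs_space T i \<Otimes>\<^sub>M history_space T i) \<Longrightarrow> 0 \<le> f i z"
  using abs_cont by (simp add: abs_continuity_def)

lemma measurable_info:
  assumes "info_set T i \<subseteq> J"
  shows "info T i \<in> measurable (obss_space T J) (obss_space T (info_set T i))"
proof -
  have "info T i = (\<lambda>ys. restrict ys (info_set T i))"
    by (simp add: info_def fun_eq_iff)
  then show ?thesis
    using assms by (simp add: obss_space_def measurable_restrict_subset)
qed

lemma measurable_actions:
  assumes "\<gamma> \<in> policies T" "I \<subseteq> DMs T" and J: "\<And>i. i \<in> I \<Longrightarrow> info_set T i \<subseteq> J"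
  shows "actions T \<gamma> I \<in> measurable (obss_space T J) (acts_space T I)"
proof -
  have "(\<lambda>ys. \<lambda>j\<in>I. \<gamma> j (info T j ys)) \<in> measurable (obss_space T J) (PiM I (act_space T))"
    using assms by (intro measurable_restrict measurable_compose[OF measurable_info])
      (auto simp: policies_def DM_policies_def Pi_iff)
  then show ?thesis
    by (simp add: acts_space_def actions_def[abs_def])
qed

lemma measurable_actions_prefix:
  assumes "\<gamma> \<in> policies T" "i \<le> Suc n" "n \<le> num_DM T"
  shows "actions T \<gamma> {1..<i} \<in> measurable (obss_space T {1..n}) (acts_space T {1..<i})"
proof (rule measurable_actions)
  show "{1..<i} \<subseteq> DMs T"
    using assms by auto
  then show "info_set T j \<subseteq> {1..n}" if "j \<in> {1..<i}" for j
    using info_set_subset[of j] assms that by fastforce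
qed fact

lemma measurable_actions_DMs:
  assumes "\<gamma> \<in> policies T"
  shows "actions T \<gamma> (DMs T) \<in> measurable (obss_space T (DMs T)) (acts_space T (DMs T))"
  using assms by (rule measurable_actions) (use info_set_subset in fastforce)+

text \<open>Causality: decision maker \<open>i\<close> sees only observations with index at most
  \<open>i\<close>, and all of these lie in \<open>J\<close>.\<close>

lemma actions_restrict:
  assumes "I \<subseteq> DMs T" "\<And>i. i \<in> I \<Longrightarrow> {1..i} \<subseteq> J"
  shows "actions T \<gamma> I (restrict ys J) = actions T \<gamma> I ys"
proof -
  have "info T i (restrict ys J) = info T i ys" if "i \<in> I" for i
  proof -
    have "info_set T i \<subseteq> J"
      using info_set_subset[of i] assms(1) assms(2)[OF that] that by blast
    then show ?thesis
      by (simp add: info_def Int_absorb1)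
  qed
  then show ?thesis
    by (simp add: actions_def cong: restrict_cong)
qed

text \<open>Each stage only adds its own coordinate and never revises earlier ones.\<close>

lemma restrict_observations:
  "m \<le> n \<Longrightarrow> restrict (observations T \<gamma> x n) {1..m} = observations T \<gamma> x m"
proof (induction n)
  case 0
  then show ?case by (auto simp: fun_eq_iff)
next
  case (Suc n)
  \<comment> \<open>Needed for \<open>m = Suc n\<close>, where the restriction must act as the
    identity: coordinates beyond the current stage still have the value
    \<open>undefined\<close>.\<close>
  have ext: "observations T \<gamma> x k j = undefined" if "j \<notin> {1..k}" for k j
    using that by (induction k) (auto simp: Let_def)
  show ?case
  proof (cases "m = Suc n")
    case True
    then show ?thesis
      by (auto simp: fun_eq_iff restrict_def ext simp del: observations.simps)
  next
    case False
    then have "restrict (observations T \<gamma> x (Suc n)) {1..m} = restrict (observations T \<gamma> x n) {1..m}"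
      using Suc.prems by (auto simp: Let_def fun_eq_iff restrict_def)
    then show ?thesis
      using Suc False by simp
  qed
qed

lemma observations_Suc_upd:
  "observations T \<gamma> x (Suc n) = (observations T \<gamma> x n)(Suc n := observations T \<gamma> x (Suc n) (Suc n))"
  by (simp add: Let_def)

lemma measurable_observations:
  assumes \<gamma>: "\<gamma> \<in> policies T"
  shows "n \<le> num_DM T \<Longrightarrow>
    (\<lambda>x. observations T \<gamma> x n) \<in> measurable (prob_meas T) (obss_space T {1..n})"
proof (induction n)
  case 0
  show ?case
    by (simp add: obss_space_def space_PiM)
next
  case (Suc n)
  let ?i = "Suc n"
  have i: "?i \<in> DMs T" and eq: "{1..<?i} = {1..n}" "{1..?i} = insert ?i {1..n}"
    using Suc.prems by auto
  have IH [measurable]: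
    "(\<lambda>x. observations T \<gamma> x n) \<in> measurable (prob_meas T) (obss_space T {1..n})"
    using Suc by simp
  have [measurable]: "actions T \<gamma> {1..<?i} \<in> measurable (obss_space T {1..n}) (acts_space T {1..<?i})"
    using Suc.prems by (intro measurable_actions_prefix \<gamma>) auto
  have [measurable]: "omega T ?i \<in> measurable (prob_meas T) (Noise T ?i)"
    and h: "obs_fun T ?i \<in> measurable
          (state_space T \<Otimes>\<^sub>M Noise T ?i \<Otimes>\<^sub>M acts_space T {1..<?i} \<Otimes>\<^sub>M obss_space T {1..<?i})
          (obs_space T ?i)"
    using sequential i unfolding sequential_team_def by blast+
  have "(\<lambda>x. obs_fun T ?i (omega0 T x, omega T ?i x,
      actions T \<gamma> {1..<?i} (observations T \<gamma> x n), observations T \<gamma> x n))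
    \<in> measurable (prob_meas T) (obs_space T ?i)"
    using IH[folded eq(1)] by (intro measurable_compose[OF _ h]) measurable
  then have "(\<lambda>x. (observations T \<gamma> x n, obs_fun T ?i (omega0 T x, omega T ?i x,
      actions T \<gamma> {1..<?i} (observations T \<gamma> x n), observations T \<gamma> x n)))
    \<in> measurable (prob_meas T) (PiM {1..n} (obs_space T) \<Otimes>\<^sub>M obs_space T ?i)"
    using IH by (simp add: obss_space_def)
  from measurable_compose[OF this measurable_add_dim] show ?case
    by (simp add: Let_def obss_space_def eq fun_upd_def del: One_nat_def)
qed

section \<open>Outcomes and histories as functions of state and observations\<close>

text \<open>Under a fixed policy the actions are functions of the observations, so the joint law and
  the reference measure are images, under this one map, of two laws of state and
  observations.\<close>

definition outcome :: "('u, 'y) policy \<Rightarrow> 'a \<times> (nat \<Rightarrow> 'y) \<Rightarrow> 'a \<times> (nat \<Rightarrow> 'u) \<times> (nat \<Rightarrow> 'y)" where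
  "outcome \<gamma> = (\<lambda>(w, ys). (w, actions T \<gamma> (DMs T) ys, ys))"

text \<open>The history of stage \<open>i\<close> in a form that makes sense for observation vectors
  of any length from \<open>i - 1\<close> on, as the induction over the stages requires;
  \<open>history\<close> reads it off a complete outcome.\<close>

definition observed_history ::
  "('u, 'y) policy \<Rightarrow> nat \<Rightarrow> 'a \<times> (nat \<Rightarrow> 'y) \<Rightarrow> ('a, 'u, 'y) history" where
  "observed_history \<gamma> i = (\<lambda>(w, ys). (w, actions T \<gamma> {1..<i} ys, restrict ys {1..<i}))"

lemma measurable_outcome:
  assumes "\<gamma> \<in> policies T"
  shows "outcome \<gamma> \<in> measurable (state_space T \<Otimes>\<^sub>M obss_space T (DMs T)) (outcome_space T)"
proof -
  note measurable_actions_DMs[OF assms, measurable]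
  show ?thesis
    unfolding outcome_def outcome_space_def by measurable
qed

lemma measurable_history:
  assumes "i \<in> DMs T"
  shows "history i \<in> measurable (outcome_space T) (history_space T i)"
proof -
  have [measurable]: "(\<lambda>us. restrict us {1..<i}) \<in> measurable (acts_space T (DMs T)) (acts_space T {1..<i})"
    "(\<lambda>ys. restrict ys {1..<i}) \<in> measurable (obss_space T (DMs T)) (obss_space T {1..<i})"
    unfolding acts_space_def obss_space_def
    using assms by (auto intro!: measurable_restrict_subset)
  show ?thesis
    unfolding history_def outcome_space_def history_space_def by measurable
qed

lemma measurable_observed_history:
  assumes "\<gamma> \<in> policies T" "i \<le> Suc n" "n \<le> num_DM T"
  shows "observed_history \<gamma> i \<in> measurable (state_space T \<Otimes>\<^sub>M obss_space T {1..n}) (history_space T i)"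
proof -
  note measurable_actions_prefix[OF assms, measurable]
  have [measurable]: "(\<lambda>ys. restrict ys {1..<i}) \<in> measurable (obss_space T {1..n}) (obss_space T {1..<i})"
    unfolding obss_space_def using assms by (intro measurable_restrict_subset) auto
  show ?thesis
    unfolding observed_history_def history_space_def by measurable
qed

lemma history_outcome:
  assumes "i \<in> DMs T"
  shows "history i (outcome \<gamma> (w, ys)) = observed_history \<gamma> i (w, ys)"
proof -
  have "DMs T \<inter> {1..<i} = {1..<i}"
    using assms by auto
  then show ?thesis
    by (simp only: history_def outcome_def observed_history_def prod.case actions_def restrict_restrict)
qed

lemma observed_history_restrict:
  assumes "i \<in> DMs T" "i \<le> Suc n"
  shows "observed_history \<gamma> i (w, restrict ys {1..n}) = observed_history \<gamma> i (w, ys)"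
proof -
  have *: "{1..<i} \<subseteq> {1..n}" using assms by auto
  have "actions T \<gamma> {1..<i} (restrict ys {1..n}) = actions T \<gamma> {1..<i} ys"
    by (rule actions_restrict) (use assms in auto)
  then show ?thesis
    using * by (simp add: observed_history_def Int_absorb1)
qed

text \<open>The two observation vectors agree on the coordinates before \<open>i\<close>, and
  \<open>observed_history_restrict\<close> shows that only these matter.\<close>

lemma observed_history_upd:
  assumes "i \<in> DMs T" "i \<le> j"
  shows "observed_history \<gamma> i (w, ys(j := y)) = observed_history \<gamma> i (w, ys)"
proof -
  obtain n where n: "i = Suc n" using assms by (cases i) auto
  have "restrict (ys(j := y)) {1..n} = restrict ys {1..n}"
    using assms n by (auto simp: restrict_def fun_eq_iff)
  then show ?thesis
    using observed_history_restrict[OF assms(1), of n \<gamma> w] n by (metis order_refl)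
qed

lemma prob_space_PiM_Q: "I \<subseteq> DMs T \<Longrightarrow> prob_space (PiM I Q)"
  by (rule prob_space_PiM, rule Q_prob_space) blast

lemma nn_integral_PiM_Q_insert:
  assumes "n < num_DM T" "\<phi> \<in> borel_measurable (obss_space T {1..Suc n})"
  shows "(\<integral>\<^sup>+ys. \<phi> ys \<partial>PiM {1..Suc n} Q) =
    (\<integral>\<^sup>+ys. (\<integral>\<^sup>+y. \<phi> (ys(Suc n := y)) \<partial>Q (Suc n)) \<partial>PiM {1..n} Q)"
proof -
  \<comment> \<open>Fubini's theorem for product measures is applied in a setting with a probability
    measure at every index, whereas \<open>Q\<close> is known to be one only at the decision makers.
    It is padded with point masses elsewhere.\<close>
  define R where "R i = (if i \<in> DMs T then Q i else return borel undefined)" for i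
  interpret R: product_prob_space R
    using Q_prob_space by (intro product_prob_spaceI) (auto simp: R_def intro: prob_space_return)
  have PiM: "PiM {1..m} R = PiM {1..m} Q" if "m \<le> num_DM T" for m
    by (rule PiM_cong) (use that in \<open>auto simp: R_def\<close>)
  have eq: "{1..Suc n} = insert (Suc n) {1..n}" by auto
  have "sets (PiM (insert (Suc n) {1..n}) R) = sets (obss_space T {1..Suc n})"
    using assms(1) by (subst eq[symmetric], subst PiM) (auto intro!: sets_PiM_Q simp del: One_nat_def)
  then have "\<phi> \<in> borel_measurable (PiM (insert (Suc n) {1..n}) R)"
    using assms(2) by (simp cong: measurable_cong_sets)
  from R.product_nn_integral_insert[OF _ _ this] show ?thesis
    using assms by (simp add: eq[symmetric] PiM R_def del: One_nat_def)
qed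

section \<open>Disintegration of the law of the observations\<close>

definition observed :: "('u, 'y) policy \<Rightarrow> nat \<Rightarrow> 'p \<Rightarrow> 'a \<times> (nat \<Rightarrow> 'y)" where
  "observed \<gamma> n x = (omega0 T x, observations T \<gamma> x n)"

lemma measurable_observed:
  assumes "\<gamma> \<in> policies T" "n \<le> num_DM T"
  shows "observed \<gamma> n \<in> measurable (prob_meas T) (state_space T \<Otimes>\<^sub>M obss_space T {1..n})"
proof -
  note measurable_observations[OF assms, measurable]
  show ?thesis
    unfolding observed_def by measurable
qed

lemma joint_law_eq: "joint_law T \<gamma> =
    distr (prob_meas T) (outcome_space T) (\<lambda>x. outcome \<gamma> (observed \<gamma> (num_DM T) x))"
  by (simp add: joint_law_def observed_def outcome_def Let_def)

lemma sets_joint_law [measurable_cong]: "sets (joint_law T \<gamma>) = sets (outcome_space T)"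
  by (simp add: joint_law_eq)

lemma space_joint_law: "space (joint_law T \<gamma>) = space (outcome_space T)"
  by (simp add: joint_law_eq)

lemma measurable_outcome_observed:
  "\<gamma> \<in> policies T \<Longrightarrow>
    (\<lambda>x. outcome \<gamma> (observed \<gamma> (num_DM T) x)) \<in> measurable (prob_meas T) (outcome_space T)"
  by (rule measurable_compose[OF measurable_observed measurable_outcome]) auto

lemma prob_space_joint_law: "\<gamma> \<in> policies T \<Longrightarrow> prob_space (joint_law T \<gamma>)"
  unfolding joint_law_eq
  by (intro prob_space.prob_space_distr prob_meas_prob_space measurable_outcome_observed)

lemma history_outcome_observed:
  assumes "i \<in> DMs T" "i = Suc n"
  shows "history i (outcome \<gamma> (observed \<gamma> (num_DM T) x)) = observed_history \<gamma> i (observed \<gamma> n x)"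
  using assms observed_history_restrict[of i n \<gamma> "omega0 T x" "observations T \<gamma> x (num_DM T)"]
  by (simp add: observed_def history_outcome restrict_observations del: One_nat_def)

lemma observation_outcome:
  assumes "i \<in> DMs T"
  shows "snd (snd (outcome \<gamma> (observed \<gamma> (num_DM T) x))) i = observations T \<gamma> x i i"
proof -
  have "restrict (observations T \<gamma> x (num_DM T)) {1..i} i = observations T \<gamma> x i i"
    using assms by (subst restrict_observations) auto
  then show ?thesis
    using assms by (simp add: observed_def outcome_def)
qed

lemma measurable_f:
  assumes "i \<in> DMs T"
  shows "(\<lambda>(h, y). ennreal (f i (y, h))) \<in> borel_measurable (history_space T i \<Otimes>\<^sub>M obs_space T i)"
proof -
  note f_measurable[OF assms, measurable]
  show ?thesis by measurable
qed

lemma measurable_observation: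
  assumes "i \<in> J"
  shows "(\<lambda>ys. ys i) \<in> measurable (obss_space T J) (obs_space T i)"
  unfolding obss_space_def using assms by (rule measurable_component_singleton)

text \<open>The absolute continuity condition, tested against a function of the history and pulled
  back to the underlying probability space. As \<open>\<psi>\<close> of the history is measurable
  for the conditioning algebra, the indicator of the event may be replaced by its conditional
  probability.\<close>

lemma conditional_law_observation:
  assumes \<gamma>: "\<gamma> \<in> policies T" and i: "i \<in> DMs T" "i = Suc n"
    and B: "B \<in> sets (obs_space T i)" and \<psi>: "\<psi> \<in> borel_measurable (history_space T i)"
  shows "(\<integral>\<^sup>+x. \<psi> (observed_history \<gamma> i (observed \<gamma> n x)) * indicator B (observations T \<gamma> x i i) \<partial>prob_meas T) =
    (\<integral>\<^sup>+x. \<psi> (observed_history \<gamma> i (observed \<gamma> n x)) *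
      (\<integral>\<^sup>+y\<in>B. ennreal (f i (y, observed_history \<gamma> i (observed \<gamma> n x))) \<partial>Q i) \<partial>prob_meas T)"
proof -
  let ?J = "joint_law T \<gamma>"
  let ?F = "vimage_algebra (space (outcome_space T)) (history i) (history_space T i)"
  let ?o = "\<lambda>x. outcome \<gamma> (observed \<gamma> (num_DM T) x)"
  let ?I = "indicator {(w, us, ys). ys i \<in> B} :: _ \<Rightarrow> ennreal"
  define \<kappa> where "\<kappa> h = (\<integral>\<^sup>+y\<in>B. ennreal (f i (y, h)) \<partial>Q i)" for h
  interpret J: prob_space ?J by (rule prob_space_joint_law[OF \<gamma>])
  interpret Q: prob_space "Q i" by (rule Q_prob_space[OF i(1)])
  note \<psi>[measurable] measurable_history[OF i(1), measurable] B[measurable]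
    measurable_outcome_observed[OF \<gamma>, measurable] sets_Q[OF i(1), measurable_cong]
    measurable_f[OF i(1), measurable] measurable_observation[OF i(1), measurable]
  have [measurable]: "\<kappa> \<in> borel_measurable (history_space T i)"
    unfolding \<kappa>_def[abs_def] by measurable
  have I_eq: "?I = (\<lambda>z. indicator B (snd (snd z) i))"
    by (auto simp: fun_eq_iff indicator_def)
  have [measurable]: "?I \<in> borel_measurable (outcome_space T)"
    unfolding I_eq outcome_space_def by measurable
  have "subalgebra ?J ?F"
    using subalgebra_vimage_algebra[of "history i" ?J "history_space T i"] by (simp add: space_joint_law)
  then interpret J: finite_measure_subalgebra ?J ?F
    by unfold_locales
  have "history i \<in> measurable ?F (history_space T i)"
    using measurable_space[OF measurable_history[OF i(1)]] by (intro measurable_vimage_algebra1) auto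
  then have F: "(\<lambda>z. \<psi> (history i z)) \<in> borel_measurable ?F"
    by measurable
  have ac: "AE z in ?J. nn_cond_exp ?J ?F ?I z = \<kappa> (history i z)"
    using abs_cont \<gamma> i(1) B unfolding abs_continuity_def \<kappa>_def by blast
  have "(\<integral>\<^sup>+x. \<psi> (history i (?o x)) * ?I (?o x) \<partial>prob_meas T) = (\<integral>\<^sup>+z. \<psi> (history i z) * ?I z \<partial>?J)"
    unfolding joint_law_eq by (rule nn_integral_distr[symmetric]) measurable
  also have "\<dots> = (\<integral>\<^sup>+z. \<psi> (history i z) * nn_cond_exp ?J ?F ?I z \<partial>?J)"
    by (rule J.nn_cond_exp_intg[symmetric, OF F]) measurable
  also have "\<dots> = (\<integral>\<^sup>+z. \<psi> (history i z) * \<kappa> (history i z) \<partial>?J)"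
    using ac by (intro nn_integral_cong_AE) auto
  also have "\<dots> = (\<integral>\<^sup>+x. \<psi> (history i (?o x)) * \<kappa> (history i (?o x)) \<partial>prob_meas T)"
    unfolding joint_law_eq by (rule nn_integral_distr) measurable
  finally show ?thesis
    unfolding I_eq observation_outcome[OF i(1)] history_outcome_observed[OF i] \<kappa>_def .
qed

text \<open>The pair of past and new observation has density \<open>f (Suc n)\<close> with respect
  to the law of the past times \<open>Q (Suc n)\<close>. The previous lemma gives this on
  rectangles, and hence it holds for all measurable integrands.\<close>

lemma nn_integral_observed_Suc:
  assumes \<gamma>: "\<gamma> \<in> policies T" and n: "n < num_DM T"
    and \<phi>: "\<phi> \<in> borel_measurable (state_space T \<Otimes>\<^sub>M obss_space T {1..Suc n})"
  shows "(\<integral>\<^sup>+x. \<phi> (observed \<gamma> (Suc n) x) \<partial>prob_meas T) =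
    (\<integral>\<^sup>+x. (case observed \<gamma> n x of (w, ys) \<Rightarrow>
      \<integral>\<^sup>+y. \<phi> (w, ys(Suc n := y)) * ennreal (f (Suc n) (y, observed_history \<gamma> (Suc n) (w, ys))) \<partial>Q (Suc n))
      \<partial>prob_meas T)"
proof -
  define i where "i = Suc n"
  define L where "L = state_space T \<Otimes>\<^sub>M obss_space T {1..n}"
  let ?o = "observed \<gamma> n" and ?y = "\<lambda>x. observations T \<gamma> x i i" and ?h = "observed_history \<gamma> i"
  have i: "i \<in> DMs T" "i = Suc n" using n by (auto simp: i_def)
  interpret P: prob_space "prob_meas T" by (rule prob_meas_prob_space)
  interpret Q: prob_space "Q i" by (rule Q_prob_space[OF i(1)])
  have [measurable]: "?o \<in> measurable (prob_meas T) L"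
    unfolding L_def using n by (intro measurable_observed \<gamma>) auto
  have [measurable]: "?h \<in> measurable L (history_space T i)"
    unfolding L_def using n by (intro measurable_observed_history \<gamma>) (auto simp: i_def)
  have [measurable]: "?y \<in> measurable (prob_meas T) (obs_space T i)"
    using n by (intro measurable_compose[OF measurable_observations[OF \<gamma>] measurable_observation])
      (auto simp: i_def)
  note sets_Q[OF i(1), measurable_cong] measurable_f[OF i(1), measurable]
  have [measurable]: "(\<lambda>(l, y). ennreal (f i (y, ?h l))) \<in> borel_measurable (L \<Otimes>\<^sub>M obs_space T i)"
    by measurable
  have space_Q: "space (Q i) = space (obs_space T i)"
    using sets_Q[OF i(1)] by (rule sets_eq_imp_space_eq)
  let ?D = "distr (prob_meas T) L ?o"
  interpret D: prob_space ?D by (rule P.prob_space_distr) measurable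
  let ?lhs = "distr (prob_meas T) (L \<Otimes>\<^sub>M obs_space T i) (\<lambda>x. (?o x, ?y x))"
  let ?rhs = "density (?D \<Otimes>\<^sub>M Q i) (\<lambda>(l, y). ennreal (f i (y, ?h l)))"
  \<comment> \<open>Rectangles form an intersection-stable generator, and the whole space is itself
    a rectangle of finite mass; agreement on rectangles therefore suffices.\<close>
  have eq: "?lhs = ?rhs"
  proof (rule measure_eqI_generator_eq[OF Int_stable_pair_measure_generator[of L "obs_space T i"],
        where \<Omega> = "space L \<times> space (obs_space T i)" and A = "\<lambda>_. space L \<times> space (obs_space T i)"])
    let ?E = "{a \<times> b |a b. a \<in> sets L \<and> b \<in> sets (obs_space T i)}"
    show "?E \<subseteq> Pow (space L \<times> space (obs_space T i))"
      by (rule pair_measure_closed)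
    show "sets ?lhs = sigma_sets (space L \<times> space (obs_space T i)) ?E"
      by (simp add: sets_pair_measure)
    have "sets ?rhs = sets (L \<Otimes>\<^sub>M obs_space T i)"
      by (simp add: sets_Q[OF i(1)] cong: sets_pair_measure_cong)
    then show "sets ?rhs = sigma_sets (space L \<times> space (obs_space T i)) ?E"
      by (simp add: sets_pair_measure)
    interpret lhs: prob_space ?lhs by (rule P.prob_space_distr) measurable
    show "emeasure ?lhs (space L \<times> space (obs_space T i)) \<noteq> \<infinity>"
      unfolding infinity_ennreal_def by (rule lhs.emeasure_finite)
    fix X assume "X \<in> ?E"
    then obtain A B where X: "X = A \<times> B" and [measurable]: "A \<in> sets L" "B \<in> sets (obs_space T i)"
      by auto
    \<comment> \<open>The history of stage \<open>n + 1\<close> contains the state and exactly the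
      first \<open>n\<close> observations, so an event \<open>A\<close> about the past is a function
      of the history that ignores the actions.\<close>
    define \<psi> :: "('a, 'u, 'y) history \<Rightarrow> ennreal" where "\<psi> = (\<lambda>(w, us, ys). indicator A (w, ys))"
    have [measurable]: "\<psi> \<in> borel_measurable (history_space T i)"
      unfolding \<psi>_def history_space_def using \<open>A \<in> sets L\<close>
      unfolding L_def i(2) atLeastLessThanSuc_atLeastAtMost by measurable
    have \<psi>: "\<psi> (?h (?o x)) = indicator A (?o x)" for x
      using restrict_observations[of n n \<gamma> x]
      by (simp add: \<psi>_def observed_history_def observed_def i(2) atLeastLessThanSuc_atLeastAtMost
          del: One_nat_def)
    have "emeasure ?lhs X = (\<integral>\<^sup>+x. \<psi> (?h (?o x)) * indicator B (?y x) \<partial>prob_meas T)"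
      unfolding \<psi> X
      by (subst nn_integral_indicator[symmetric])
        (auto simp: nn_integral_distr indicator_times simp del: nn_integral_indicator)
    also have "\<dots> = (\<integral>\<^sup>+x. \<psi> (?h (?o x)) *
        (\<integral>\<^sup>+y\<in>B. ennreal (f i (y, ?h (?o x))) \<partial>Q i) \<partial>prob_meas T)"
      by (rule conditional_law_observation[OF \<gamma> i]) measurable
    also have "\<dots> = (\<integral>\<^sup>+l. indicator A l * (\<integral>\<^sup>+y\<in>B. ennreal (f i (y, ?h l)) \<partial>Q i) \<partial>?D)"
      unfolding \<psi> by (rule nn_integral_distr[symmetric]) measurable
    also have "\<dots> = (\<integral>\<^sup>+l. (\<integral>\<^sup>+y. ennreal (f i (y, ?h l)) * indicator X (l, y) \<partial>Q i) \<partial>?D)"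
    proof (rule nn_integral_cong)
      fix l assume "l \<in> space ?D"
      then have [measurable]: "l \<in> space L" by simp
      show "indicator A l * (\<integral>\<^sup>+y\<in>B. ennreal (f i (y, ?h l)) \<partial>Q i) =
          (\<integral>\<^sup>+y. ennreal (f i (y, ?h l)) * indicator X (l, y) \<partial>Q i)"
        unfolding X by (subst nn_integral_cmult[symmetric]) (measurable, auto simp: indicator_times ac_simps)
    qed
    also have "\<dots> = (\<integral>\<^sup>+z. (case z of (l, y) \<Rightarrow> ennreal (f i (y, ?h l))) * indicator X z \<partial>(?D \<Otimes>\<^sub>M Q i))"
      unfolding X by (subst Q.nn_integral_fst[symmetric]) auto
    also have "\<dots> = emeasure ?rhs X"
      unfolding X by (rule emeasure_density[symmetric]) measurable
    finally show "emeasure ?lhs X = emeasure ?rhs X" .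
  qed auto
  have eqI: "{1..Suc n} = insert i {1..n}" by (auto simp: i_def)
  have [measurable]: "(\<lambda>(ys, y). ys(i := y)) \<in> measurable (obss_space T {1..n} \<Otimes>\<^sub>M obs_space T i) (obss_space T {1..Suc n})"
    unfolding obss_space_def eqI by (rule measurable_add_dim)
  have [measurable]: "(\<lambda>(l, y). \<phi> (fst l, (snd l)(i := y))) \<in> borel_measurable (L \<Otimes>\<^sub>M obs_space T i)"
    using \<phi> unfolding L_def by measurable
  \<comment> \<open>Stage \<open>n + 1\<close> is the past with one coordinate added, so the
    integral depends only on the law of the pair just identified.\<close>
  have "(\<integral>\<^sup>+x. \<phi> (observed \<gamma> (Suc n) x) \<partial>prob_meas T) =
      (\<integral>\<^sup>+x. (case (?o x, ?y x) of (l, y) \<Rightarrow> \<phi> (fst l, (snd l)(i := y))) \<partial>prob_meas T)"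
    unfolding i_def prod.case observed_def fst_conv snd_conv by (subst observations_Suc_upd) rule
  also have "\<dots> = (\<integral>\<^sup>+z. (case z of (l, y) \<Rightarrow> \<phi> (fst l, (snd l)(i := y))) \<partial>?lhs)"
    by (rule nn_integral_distr[symmetric]) measurable
  also have "\<dots> = (\<integral>\<^sup>+z. (case z of (l, y) \<Rightarrow> \<phi> (fst l, (snd l)(i := y)) * ennreal (f i (y, ?h l))) \<partial>(?D \<Otimes>\<^sub>M Q i))"
    unfolding eq by (subst nn_integral_density) (auto simp: split_beta' mult.commute)
  also have "\<dots> = (\<integral>\<^sup>+l. \<integral>\<^sup>+y. \<phi> (fst l, (snd l)(i := y)) * ennreal (f i (y, ?h l)) \<partial>Q i \<partial>?D)"
    by (subst Q.nn_integral_fst[symmetric]) auto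
  also have "\<dots> = (\<integral>\<^sup>+x. \<integral>\<^sup>+y. \<phi> (fst (?o x), (snd (?o x))(i := y)) * ennreal (f i (y, ?h (?o x))) \<partial>Q i \<partial>prob_meas T)"
    by (rule nn_integral_distr) measurable
  finally show ?thesis
    by (simp add: i_def split_beta')
qed

section \<open>The reference measure\<close>

text \<open>The partial product of dP/dQ over the first \<open>n\<close> stages, with the actions
  already expressed through the observations.\<close>

definition likelihood :: "('u, 'y) policy \<Rightarrow> nat \<Rightarrow> 'a \<times> (nat \<Rightarrow> 'y) \<Rightarrow> ennreal" where
  "likelihood \<gamma> n l = (\<Prod>i\<in>{1..n}. ennreal (f i (snd l i, observed_history \<gamma> i l)))"

text \<open>The first \<open>n\<close> factors do not see coordinate \<open>n + 1\<close>, by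
  \<open>observed_history_upd\<close>.\<close>

lemma likelihood_Suc:
  assumes "n < num_DM T"
  shows "likelihood \<gamma> (Suc n) (w, ys(Suc n := y)) =
    likelihood \<gamma> n (w, ys) * ennreal (f (Suc n) (y, observed_history \<gamma> (Suc n) (w, ys)))"
proof -
  have "{1..Suc n} = insert (Suc n) {1..n}" by auto
  moreover have "(\<Prod>i\<in>{1..n}. ennreal (f i ((ys(Suc n := y)) i, observed_history \<gamma> i (w, ys(Suc n := y))))) =
      (\<Prod>i\<in>{1..n}. ennreal (f i (ys i, observed_history \<gamma> i (w, ys))))"
    using assms by (intro prod.cong) (auto simp: observed_history_upd)
  ultimately show ?thesis
    using assms by (simp add: likelihood_def observed_history_upd mult.commute del: One_nat_def)
qed

lemma measurable_likelihood:
  assumes "\<gamma> \<in> policies T" "n \<le> num_DM T"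
  shows "likelihood \<gamma> n \<in> borel_measurable (state_space T \<Otimes>\<^sub>M obss_space T {1..n})"
proof -
  have "(\<lambda>l. ennreal (f i (snd l i, observed_history \<gamma> i l)))
      \<in> borel_measurable (state_space T \<Otimes>\<^sub>M obss_space T {1..n})" if "i \<in> {1..n}" for i
  proof -
    have i: "i \<in> DMs T" using assms that by auto
    note measurable_observation[OF that, measurable] measurable_f[OF i, measurable]
    have [measurable]: "observed_history \<gamma> i \<in> measurable (state_space T \<Otimes>\<^sub>M obss_space T {1..n}) (history_space T i)"
      using assms that by (intro measurable_observed_history) auto
    show ?thesis by measurable
  qed
  then show ?thesis
    unfolding likelihood_def[abs_def] by (rule borel_measurable_prod_ennreal)
qed

abbreviation state_law :: "'a measure" where
  "state_law \<equiv> distr (prob_meas T) (state_space T) (omega0 T)"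

lemma prob_space_state_law: "prob_space state_law"
  by (rule prob_space.prob_space_distr[OF prob_meas_prob_space]) measurable

text \<open>Iterates the one-stage formula. The integrand is left arbitrary in the induction because
  the hypothesis is applied to \<open>\<phi>\<close> with its last observation integrated
  out.\<close>

lemma nn_integral_observed:
  assumes \<gamma>: "\<gamma> \<in> policies T"
  shows "n \<le> num_DM T \<Longrightarrow> \<phi> \<in> borel_measurable (state_space T \<Otimes>\<^sub>M obss_space T {1..n}) \<Longrightarrow>
    (\<integral>\<^sup>+x. \<phi> (observed \<gamma> n x) \<partial>prob_meas T) =
    (\<integral>\<^sup>+w. \<integral>\<^sup>+ys. \<phi> (w, ys) * likelihood \<gamma> n (w, ys) \<partial>PiM {1..n} Q \<partial>state_law)"
proof (induction n arbitrary: \<phi>)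
  case 0
  \<comment> \<open>With no observations the product measure is the point mass at the empty family
    and the likelihood is an empty product.\<close>
  have "(\<lambda>w. (w, \<lambda>_. undefined)) \<in> measurable (state_space T) (state_space T \<Otimes>\<^sub>M obss_space T {1..0})"
    by (intro measurable_Pair measurable_ident_sets refl measurable_const)
      (simp add: obss_space_def space_PiM)
  from measurable_compose[OF this 0(2)] show ?case
    by (simp add: observed_def likelihood_def nn_integral_distr PiM_empty nn_integral_count_space_finite)
next
  case (Suc n)
  let ?i = "Suc n"
  let ?h = "observed_history \<gamma> ?i"
  have n: "n < num_DM T" and i: "?i \<in> DMs T" using Suc.prems by auto
  have eq: "{1..?i} = insert ?i {1..n}" by auto
  interpret Q: prob_space "Q ?i" by (rule Q_prob_space[OF i])
  note \<phi>[measurable] = Suc.prems(2)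
  note sets_Q[OF i, measurable_cong] measurable_f[OF i, measurable]
  have sets_PiM [measurable_cong]: "sets (PiM {1..n} Q) = sets (obss_space T {1..n})"
    using n by (intro sets_PiM_Q) auto
  have [measurable]: "?h \<in> measurable (state_space T \<Otimes>\<^sub>M obss_space T {1..n}) (history_space T ?i)"
    using n by (intro measurable_observed_history \<gamma>) auto
  have [measurable]: "(\<lambda>(ys, y). ys(?i := y)) \<in>
      measurable (obss_space T {1..n} \<Otimes>\<^sub>M obs_space T ?i) (obss_space T {1..?i})"
    unfolding obss_space_def eq by (rule measurable_add_dim)
  have [measurable]: "likelihood \<gamma> n \<in> borel_measurable (state_space T \<Otimes>\<^sub>M obss_space T {1..n})"
    "likelihood \<gamma> ?i \<in> borel_measurable (state_space T \<Otimes>\<^sub>M obss_space T {1..?i})"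
    using n by (auto intro!: measurable_likelihood \<gamma> simp del: One_nat_def)
  \<comment> \<open>The integrand for the induction hypothesis: the last observation is averaged out
    under its conditional law given the past.\<close>
  let ?\<psi> = "\<lambda>(w, ys). \<integral>\<^sup>+y. \<phi> (w, ys(?i := y)) * ennreal (f ?i (y, ?h (w, ys))) \<partial>Q ?i"
  have inner [measurable]:
    "(\<lambda>x. \<phi> (fst (fst x), (snd (fst x))(?i := snd x)) * ennreal (f ?i (snd x, ?h (fst x))))
      \<in> borel_measurable ((state_space T \<Otimes>\<^sub>M obss_space T {1..n}) \<Otimes>\<^sub>M obs_space T ?i)"
    by measurable
  have \<psi>: "?\<psi> \<in> borel_measurable (state_space T \<Otimes>\<^sub>M obss_space T {1..n})"
    unfolding split_beta' prod.collapse
    by (intro Q.borel_measurable_nn_integral) (use inner in \<open>simp add: split_beta' sets_Q[OF i] cong: measurable_cong_sets sets_pair_measure_cong\<close>)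
  have "(\<integral>\<^sup>+x. \<phi> (observed \<gamma> ?i x) \<partial>prob_meas T) = (\<integral>\<^sup>+x. ?\<psi> (observed \<gamma> n x) \<partial>prob_meas T)"
    by (rule nn_integral_observed_Suc[OF \<gamma> n \<phi>])
  also have "\<dots> = (\<integral>\<^sup>+w. \<integral>\<^sup>+ys. ?\<psi> (w, ys) * likelihood \<gamma> n (w, ys) \<partial>PiM {1..n} Q \<partial>state_law)"
    using n by (intro Suc.IH \<psi>) auto
  also have "\<dots> = (\<integral>\<^sup>+w. \<integral>\<^sup>+ys. \<phi> (w, ys) * likelihood \<gamma> ?i (w, ys) \<partial>PiM {1..?i} Q \<partial>state_law)"
  proof (rule nn_integral_cong)
    fix w assume "w \<in> space state_law"
    then have w [measurable]: "w \<in> space (state_space T)" by simp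
    \<comment> \<open>Fubini splits off the last coordinate; by \<open>likelihood_Suc\<close> the
      earlier factors are constant in it and leave the inner integral.\<close>
    have "(\<integral>\<^sup>+ys. \<phi> (w, ys) * likelihood \<gamma> ?i (w, ys) \<partial>PiM {1..?i} Q) =
        (\<integral>\<^sup>+ys. \<integral>\<^sup>+y. \<phi> (w, ys(?i := y)) * likelihood \<gamma> ?i (w, ys(?i := y)) \<partial>Q ?i \<partial>PiM {1..n} Q)"
      by (rule nn_integral_PiM_Q_insert[OF n]) measurable
    also have "\<dots> = (\<integral>\<^sup>+ys. ?\<psi> (w, ys) * likelihood \<gamma> n (w, ys) \<partial>PiM {1..n} Q)"
    proof (rule nn_integral_cong)
      fix ys assume "ys \<in> space (PiM {1..n} Q)"
      then have "ys \<in> space (obss_space T {1..n})"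
        using sets_eq_imp_space_eq[OF sets_PiM] by simp
      then have "(w, ys) \<in> space (state_space T \<Otimes>\<^sub>M obss_space T {1..n})"
        using w by (simp add: space_pair_measure)
      from measurable_compose[OF measurable_Pair1'[OF this] inner]
      have [measurable]: "(\<lambda>y. \<phi> (w, ys(?i := y)) * ennreal (f ?i (y, ?h (w, ys)))) \<in> borel_measurable (Q ?i)"
        by (simp add: sets_Q[OF i] cong: measurable_cong_sets)
      show "(\<integral>\<^sup>+y. \<phi> (w, ys(?i := y)) * likelihood \<gamma> ?i (w, ys(?i := y)) \<partial>Q ?i) =
          ?\<psi> (w, ys) * likelihood \<gamma> n (w, ys)"
        unfolding likelihood_Suc[OF n] prod.case
        by (subst nn_integral_multc[symmetric]) (measurable, simp add: ac_simps)
    qed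
    finally show "(\<integral>\<^sup>+ys. ?\<psi> (w, ys) * likelihood \<gamma> n (w, ys) \<partial>PiM {1..n} Q) =
      (\<integral>\<^sup>+ys. \<phi> (w, ys) * likelihood \<gamma> ?i (w, ys) \<partial>PiM {1..?i} Q)" ..
  qed
  finally show ?case .
qed

section \<open>The joint law as a density over the reference measure\<close>

lemma sets_ref_measure [measurable_cong]: "sets (ref_measure T Q \<gamma>) = sets (outcome_space T)"
  by (simp add: ref_measure_def)

lemma space_ref_measure: "space (ref_measure T Q \<gamma>) = space (outcome_space T)"
  by (simp add: ref_measure_def)

lemma ref_measure_eq: "ref_measure T Q \<gamma> = distr (state_law \<Otimes>\<^sub>M PiM (DMs T) Q) (outcome_space T) (outcome \<gamma>)"
  by (simp add: ref_measure_def outcome_def)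

lemma sets_state_law_PiM_Q [measurable_cong]:
  "sets (state_law \<Otimes>\<^sub>M PiM (DMs T) Q) = sets (state_space T \<Otimes>\<^sub>M obss_space T (DMs T))"
  by (intro sets_pair_measure_cong sets_PiM_Q) auto

lemma measurable_outcome_Q:
  "\<gamma> \<in> policies T \<Longrightarrow> outcome \<gamma> \<in> measurable (state_law \<Otimes>\<^sub>M PiM (DMs T) Q) (outcome_space T)"
  unfolding measurable_cong_sets[OF sets_state_law_PiM_Q refl] by (rule measurable_outcome)

lemma prob_space_ref_measure:
  assumes "\<gamma> \<in> policies T"
  shows "prob_space (ref_measure T Q \<gamma>)"
proof -
  interpret S: prob_space state_law by (rule prob_space_state_law)
  interpret Y: prob_space "PiM (DMs T) Q" by (rule prob_space_PiM_Q) simp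
  interpret SY: pair_prob_space state_law "PiM (DMs T) Q" ..
  show ?thesis
    unfolding ref_measure_eq by (rule SY.prob_space_distr[OF measurable_outcome_Q[OF assms]])
qed

lemma dP_dQ_factor:
  assumes i: "i \<in> DMs T"
  shows "(\<lambda>z. f i (snd (snd z) i, history i z)) \<in> borel_measurable (outcome_space T)"
    and "z \<in> space (outcome_space T) \<Longrightarrow> 0 \<le> f i (snd (snd z) i, history i z)"
proof -
  note measurable_observation[OF i, measurable]
  have m: "(\<lambda>z. (snd (snd z) i, history i z)) \<in> measurable (outcome_space T) (obs_space T i \<Otimes>\<^sub>M history_space T i)"
    by (intro measurable_Pair measurable_history i) (unfold outcome_space_def, measurable)
  show "(\<lambda>z. f i (snd (snd z) i, history i z)) \<in> borel_measurable (outcome_space T)"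
    by (rule measurable_compose[OF m f_measurable[OF i]])
  show "0 \<le> f i (snd (snd z) i, history i z)" if "z \<in> space (outcome_space T)"
    by (rule f_nonneg[OF i measurable_space[OF m that]])
qed

lemma dP_dQ_nonneg: "z \<in> space (outcome_space T) \<Longrightarrow> 0 \<le> dP_dQ T f z"
  unfolding dP_dQ_def by (intro prod_nonneg ballI dP_dQ_factor)

lemma measurable_dP_dQ [measurable]: "dP_dQ T f \<in> borel_measurable (outcome_space T)"
  unfolding dP_dQ_def[abs_def] by (intro borel_measurable_prod dP_dQ_factor)

text \<open>On an outcome produced by \<open>\<gamma>\<close> the recorded history is the
  \<open>observed_history\<close>, so the factors agree one by one. Their nonnegativity lets
  \<open>ennreal\<close> pass through the product.\<close>

lemma dP_dQ_outcome:
  assumes "\<gamma> \<in> policies T" "l \<in> space (state_space T \<Otimes>\<^sub>M obss_space T (DMs T))"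
  shows "ennreal (dP_dQ T f (outcome \<gamma> l)) = likelihood \<gamma> (num_DM T) l"
proof -
  have z: "outcome \<gamma> l \<in> space (outcome_space T)"
    using measurable_space[OF measurable_outcome] assms by blast
  have "snd (snd (outcome \<gamma> l)) = snd l"
    by (simp add: outcome_def split_beta)
  then have factor: "f i (snd (snd (outcome \<gamma> l)) i, history i (outcome \<gamma> l)) =
      f i (snd l i, observed_history \<gamma> i l)" if "i \<in> DMs T" for i
    using history_outcome[OF that, of \<gamma> "fst l" "snd l"] by simp
  have "likelihood \<gamma> (num_DM T) l =
      (\<Prod>i\<in>DMs T. ennreal (f i (snd (snd (outcome \<gamma> l)) i, history i (outcome \<gamma> l))))"
    unfolding likelihood_def by (intro prod.cong) (simp_all add: factor)
  also have "\<dots> = ennreal (dP_dQ T f (outcome \<gamma> l))"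
    unfolding dP_dQ_def by (rule prod_ennreal) (rule dP_dQ_factor(2)[OF _ z])
  finally show ?thesis ..
qed

text \<open>\<open>nn_integral_observed\<close> at the last stage, applied to the indicator of
  \<open>A\<close> composed with \<open>outcome \<gamma>\<close>; the iterated integral is then
  merged and pushed forward to outcomes.\<close>

lemma joint_law_eq_density:
  assumes \<gamma>: "\<gamma> \<in> policies T"
  shows "joint_law T \<gamma> = density (ref_measure T Q \<gamma>) (\<lambda>z. ennreal (dP_dQ T f z))"
proof (rule measure_eqI)
  interpret Y: prob_space "PiM (DMs T) Q" by (rule prob_space_PiM_Q) simp
  note measurable_outcome[OF \<gamma>, measurable] measurable_likelihood[OF \<gamma> order_refl, measurable]
    measurable_outcome_Q[OF \<gamma>, measurable]
  let ?N = "num_DM T"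
  fix A assume "A \<in> sets (joint_law T \<gamma>)"
  then have A [measurable]: "A \<in> sets (outcome_space T)" by (simp add: sets_joint_law)
  have "emeasure (joint_law T \<gamma>) A = (\<integral>\<^sup>+z. indicator A z \<partial>joint_law T \<gamma>)"
    by (simp add: sets_joint_law)
  also have "\<dots> = (\<integral>\<^sup>+x. indicator A (outcome \<gamma> (observed \<gamma> ?N x)) \<partial>prob_meas T)"
    unfolding joint_law_eq by (rule nn_integral_distr[OF measurable_outcome_observed[OF \<gamma>]]) measurable
  also have "\<dots> = (\<integral>\<^sup>+w. \<integral>\<^sup>+ys. indicator A (outcome \<gamma> (w, ys)) * likelihood \<gamma> ?N (w, ys) \<partial>PiM (DMs T) Q \<partial>state_law)"
    by (rule nn_integral_observed[OF \<gamma> order_refl]) measurable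
  also have "\<dots> = (\<integral>\<^sup>+l. indicator A (outcome \<gamma> l) * likelihood \<gamma> ?N l \<partial>(state_law \<Otimes>\<^sub>M PiM (DMs T) Q))"
    by (rule Y.nn_integral_fst) measurable
  also have "\<dots> = (\<integral>\<^sup>+l. indicator A (outcome \<gamma> l) * ennreal (dP_dQ T f (outcome \<gamma> l)) \<partial>(state_law \<Otimes>\<^sub>M PiM (DMs T) Q))"
    using sets_eq_imp_space_eq[OF sets_state_law_PiM_Q]
    by (intro nn_integral_cong) (simp add: dP_dQ_outcome[OF \<gamma>])
  also have "\<dots> = (\<integral>\<^sup>+z. indicator A z * ennreal (dP_dQ T f z) \<partial>ref_measure T Q \<gamma>)"
    unfolding ref_measure_eq by (rule nn_integral_distr[symmetric]) measurable
  also have "\<dots> = emeasure (density (ref_measure T Q \<gamma>) (\<lambda>z. ennreal (dP_dQ T f z))) A"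
    by (subst emeasure_density) (auto simp: sets_ref_measure mult.commute)
  finally show "emeasure (joint_law T \<gamma>) A = \<dots>" .
qed (simp add: sets_joint_law sets_ref_measure)

section \<open>Equality of expected costs and of the optimality notions\<close>

lemma measurable_team_cost [measurable]: "team_cost T \<in> borel_measurable (outcome_space T)"
proof -
  have [measurable]: "cost T \<in> borel_measurable (state_space T \<Otimes>\<^sub>M acts_space T (DMs T))"
    using sequential by (simp add: sequential_team_def)
  show ?thesis
    unfolding team_cost_def outcome_space_def by measurable
qed

lemma measurable_reduced_cost [measurable]: "reduced_cost T f \<in> borel_measurable (outcome_space T)"
  unfolding reduced_cost_def[abs_def] by measurable

lemma ennreal_reduced_cost:
  assumes "z \<in> space (outcome_space T)"
  shows "ennreal (reduced_cost T f z) = ennreal (team_cost T z) * ennreal (dP_dQ T f z)"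
  unfolding reduced_cost_def by (rule ennreal_mult'') (rule dP_dQ_nonneg[OF assms])

lemma exp_cost_reduction:
  assumes \<gamma>: "\<gamma> \<in> policies T"
  shows "exp_cost (joint_law T) (team_cost T) \<gamma> = exp_cost (ref_measure T Q) (reduced_cost T f) \<gamma>"
  unfolding exp_cost_def joint_law_eq_density[OF \<gamma>]
  by (subst nn_integral_density)
    (measurable, auto intro!: nn_integral_cong simp: space_ref_measure ennreal_reduced_cost mult.commute)

lemma policies_upd: "\<gamma> \<in> policies T \<Longrightarrow> \<beta> \<in> DM_policies T i \<Longrightarrow> \<gamma>(i := \<beta>) \<in> policies T"
  by (auto simp: policies_def Pi_iff)

text \<open>A unilateral deviation yields a policy again, so \<open>exp_cost_reduction\<close>
  applies to both sides of each inequality.\<close>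

lemma pbp_optimal_reduction:
  assumes "\<gamma> \<in> policies T"
  shows "pbp_optimal T (joint_law T) (team_cost T) \<gamma> \<longleftrightarrow>
    pbp_optimal T (ref_measure T Q) (reduced_cost T f) \<gamma>"
  using assms unfolding pbp_optimal_def
  by (intro ball_cong refl) (simp add: exp_cost_reduction policies_upd)

lemma globally_optimal_reduction:
  assumes "\<gamma> \<in> policies T"
  shows "globally_optimal T (joint_law T) (team_cost T) \<gamma> \<longleftrightarrow>
    globally_optimal T (ref_measure T Q) (reduced_cost T f) \<gamma>"
  using assms by (simp add: globally_optimal_def exp_cost_reduction cong: INF_cong_simp)

section \<open>Stationarity\<close>

abbreviation info_algebra :: "nat \<Rightarrow> ('a \<times> (nat \<Rightarrow> 'u) \<times> (nat \<Rightarrow> 'y)) measure" where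
  "info_algebra i \<equiv> vimage_algebra (space (outcome_space T)) (\<lambda>(w, us, ys). info T i ys)
     (obss_space T (info_set T i))"

lemma measurable_outcome_info:
  assumes "i \<in> DMs T"
  shows "(\<lambda>(w, us, ys). info T i ys) \<in> measurable (outcome_space T) (obss_space T (info_set T i))"
proof -
  have "info_set T i \<subseteq> DMs T"
    using info_set_subset[OF assms] assms by auto
  note measurable_info[OF this, measurable]
  show ?thesis
    unfolding outcome_space_def by measurable
qed

text \<open>Once the action is chosen by \<open>\<beta>\<close>, a version depends on the
  information alone. This makes the equality of a version with a conditional expectation an event of
  \<open>info_algebra i\<close>, as \<open>AE_density_F\<close> demands.\<close>

lemma measurable_info_algebra:
  assumes i: "i \<in> DMs T" and \<beta>: "\<beta> \<in> DM_policies T i"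
    and g: "g \<in> borel_measurable (act_space T i \<Otimes>\<^sub>M obss_space T (info_set T i))"
  shows "(\<lambda>z. g (\<beta> (info T i (snd (snd z))), info T i (snd (snd z)))) \<in> borel_measurable (info_algebra i)"
proof -
  have "(\<lambda>(w, us, ys). info T i ys) \<in> measurable (info_algebra i) (obss_space T (info_set T i))"
    using measurable_space[OF measurable_outcome_info[OF i]] by (intro measurable_vimage_algebra1) auto
  then have [measurable]: "(\<lambda>z. info T i (snd (snd z))) \<in> measurable (info_algebra i) (obss_space T (info_set T i))"
    by (simp add: split_beta')
  note \<beta>[unfolded DM_policies_def, measurable] g[measurable]
  show ?thesis by measurable
qed

lemma density_subalgebra_ref_measure:
  assumes \<gamma>: "\<gamma> \<in> policies T" and i: "i \<in> DMs T"
  shows "density_subalgebra (ref_measure T Q \<gamma>) (info_algebra i) (\<lambda>z. ennreal (dP_dQ T f z))"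
proof (rule density_subalgebra.intro)
  show "finite_measure (ref_measure T Q \<gamma>)"
    using prob_space_ref_measure[OF \<gamma>] by (simp add: prob_space_def)
  \<comment> \<open>This density is the joint law, hence a probability measure.\<close>
  show "finite_measure (density (ref_measure T Q \<gamma>) (\<lambda>z. ennreal (dP_dQ T f z)))"
    using prob_space_joint_law[OF \<gamma>] by (simp add: prob_space_def joint_law_eq_density[OF \<gamma>])
  show "subalgebra (ref_measure T Q \<gamma>) (info_algebra i)"
    using subalgebra_vimage_algebra[of _ "ref_measure T Q \<gamma>"] measurable_outcome_info[OF i]
    by (simp add: space_ref_measure sets_ref_measure cong: measurable_cong_sets)
qed measurable

lemma nn_cond_exp_reduced_cost:
  assumes \<gamma>: "\<gamma> \<in> policies T" and i: "i \<in> DMs T"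
  shows "AE z in ref_measure T Q \<gamma>.
    nn_cond_exp (ref_measure T Q \<gamma>) (info_algebra i) (\<lambda>z. ennreal (reduced_cost T f z)) z =
    nn_cond_exp (ref_measure T Q \<gamma>) (info_algebra i) (\<lambda>z. ennreal (team_cost T z) * ennreal (dP_dQ T f z)) z"
proof -
  interpret density_subalgebra "ref_measure T Q \<gamma>" "info_algebra i" "\<lambda>z. ennreal (dP_dQ T f z)"
    by (rule density_subalgebra_ref_measure[OF \<gamma> i])
  show ?thesis
    by (rule M.nn_cond_exp_cong) (measurable, auto simp: space_ref_measure ennreal_reduced_cost intro!: AE_I2)
qed

text \<open>Bayes' formula in product form, for each deviation \<open>\<beta>\<close>
  separately.\<close>

lemma cond_exp_version_mult:
  assumes \<gamma>: "\<gamma> \<in> policies T" and i: "i \<in> DMs T"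
    and k: "cond_exp_version T (joint_law T) (team_cost T) \<gamma> i k"
    and h: "cond_exp_version T (ref_measure T Q) (dP_dQ T f) \<gamma> i h"
  shows "cond_exp_version T (ref_measure T Q) (reduced_cost T f) \<gamma> i (\<lambda>x. k x * h x)"
  unfolding cond_exp_version_def
proof (intro conjI ballI)
  note [measurable] = k[unfolded cond_exp_version_def, THEN conjunct1]
    h[unfolded cond_exp_version_def, THEN conjunct1]
  show "(\<lambda>x. k x * h x) \<in> borel_measurable (act_space T i \<Otimes>\<^sub>M obss_space T (info_set T i))"
    by measurable
  fix \<beta> assume \<beta>: "\<beta> \<in> DM_policies T i"
  have \<gamma>\<beta>: "\<gamma>(i := \<beta>) \<in> policies T" by (rule policies_upd[OF \<gamma> \<beta>])
  let ?R = "ref_measure T Q (\<gamma>(i := \<beta>))" and ?F = "info_algebra i"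
  let ?D = "\<lambda>z. ennreal (dP_dQ T f z)" and ?c = "\<lambda>z. ennreal (team_cost T z)"
  let ?x = "\<lambda>z. (\<beta> (info T i (snd (snd z))), info T i (snd (snd z)))"
  interpret density_subalgebra ?R ?F ?D
    by (rule density_subalgebra_ref_measure[OF \<gamma>\<beta> i])
  note [measurable] = measurable_info_algebra[OF i \<beta>]
  have "AE z in density ?R ?D. nn_cond_exp (density ?R ?D) ?F ?c z = k (?x z)"
    using k \<beta> unfolding cond_exp_version_def joint_law_eq_density[OF \<gamma>\<beta>, symmetric] by blast
  \<comment> \<open>\<open>k\<close> is known to be correct only almost surely under the joint law.
    Seen from the reference measure, it can fail only where the conditional density is zero, and
    there both products are zero.\<close>
  then have "AE z in ?R. nn_cond_exp ?R ?F ?D z \<noteq> 0 \<longrightarrow> nn_cond_exp (density ?R ?D) ?F ?c z = k (?x z)"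
    by (subst (asm) AE_density_F) measurable
  moreover have "AE z in ?R. nn_cond_exp ?R ?F ?D z = h (?x z)"
    using h \<beta> unfolding cond_exp_version_def by blast
  moreover have "AE z in ?R. nn_cond_exp ?R ?F (\<lambda>z. ?c z * ?D z) z =
      nn_cond_exp (density ?R ?D) ?F ?c z * nn_cond_exp ?R ?F ?D z"
    by (rule nn_cond_exp_times_density) measurable
  ultimately show "AE z in ?R. nn_cond_exp ?R ?F (\<lambda>z. ennreal (reduced_cost T f z)) z = k (?x z) * h (?x z)"
    using nn_cond_exp_reduced_cost[OF \<gamma>\<beta> i] by eventually_elim auto
qed

text \<open>Bayes' formula in quotient form, again for each deviation. Zeros of \<open>h\<close> do
  no harm: under the joint law of the deviation the conditional density is almost surely
  nonzero.\<close>

lemma cond_exp_version_quotient: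
  assumes \<gamma>: "\<gamma> \<in> policies T" and i: "i \<in> DMs T"
    and g: "cond_exp_version T (ref_measure T Q) (reduced_cost T f) \<gamma> i g"
    and h: "cond_exp_version T (ref_measure T Q) (dP_dQ T f) \<gamma> i h"
  shows "cond_exp_version T (joint_law T) (team_cost T) \<gamma> i (\<lambda>x. g x * inverse (h x))"
  unfolding cond_exp_version_def
proof (intro conjI ballI)
  note [measurable] = g[unfolded cond_exp_version_def, THEN conjunct1]
    h[unfolded cond_exp_version_def, THEN conjunct1]
  show "(\<lambda>x. g x * inverse (h x)) \<in> borel_measurable (act_space T i \<Otimes>\<^sub>M obss_space T (info_set T i))"
    by measurable
  fix \<beta> assume \<beta>: "\<beta> \<in> DM_policies T i"
  have \<gamma>\<beta>: "\<gamma>(i := \<beta>) \<in> policies T" by (rule policies_upd[OF \<gamma> \<beta>])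
  let ?R = "ref_measure T Q (\<gamma>(i := \<beta>))" and ?F = "info_algebra i"
  let ?D = "\<lambda>z. ennreal (dP_dQ T f z)" and ?c = "\<lambda>z. ennreal (team_cost T z)"
  let ?x = "\<lambda>z. (\<beta> (info T i (snd (snd z))), info T i (snd (snd z)))"
  interpret density_subalgebra ?R ?F ?D
    by (rule density_subalgebra_ref_measure[OF \<gamma>\<beta> i])
  have "AE z in ?R. nn_cond_exp ?R ?F (\<lambda>z. ennreal (reduced_cost T f z)) z = g (?x z)"
    using g \<beta> unfolding cond_exp_version_def by blast
  moreover have "AE z in ?R. nn_cond_exp ?R ?F ?D z = h (?x z)"
    using h \<beta> unfolding cond_exp_version_def by blast
  ultimately have "AE z in ?R. nn_cond_exp ?R ?F (\<lambda>z. ?c z * ?D z) z * inverse (nn_cond_exp ?R ?F ?D z) =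
      g (?x z) * inverse (h (?x z))"
    using nn_cond_exp_reduced_cost[OF \<gamma>\<beta> i] by eventually_elim simp
  moreover have "AE z in density ?R ?D. nn_cond_exp (density ?R ?D) ?F ?c z =
      nn_cond_exp ?R ?F (\<lambda>z. ?c z * ?D z) z * inverse (nn_cond_exp ?R ?F ?D z)"
    by (rule nn_cond_exp_density_quotient) measurable
  \<comment> \<open>Identities that hold almost surely under the reference measure persist under the
    joint law, which has a density with respect to it.\<close>
  ultimately show "AE z in joint_law T (\<gamma>(i := \<beta>)).
      nn_cond_exp (joint_law T (\<gamma>(i := \<beta>))) ?F ?c z = g (?x z) * inverse (h (?x z))"
    unfolding joint_law_eq_density[OF \<gamma>\<beta>] by (auto dest: AE_density_of_AE elim: AE_mp)
qed

text \<open>At the action actually used, \<open>h\<close> is the conditional density, which is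
  nonzero almost surely under the joint law. This permits the quotient rule at that action.\<close>

lemma cond_exp_version_dP_dQ_nonzero:
  assumes \<gamma>: "\<gamma> \<in> policies T" and i: "i \<in> DMs T"
    and h: "cond_exp_version T (ref_measure T Q) (dP_dQ T f) \<gamma> i h"
  shows "AE z in joint_law T \<gamma>. h (\<gamma> i (info T i (snd (snd z))), info T i (snd (snd z))) \<noteq> 0"
proof -
  interpret density_subalgebra "ref_measure T Q \<gamma>" "info_algebra i" "\<lambda>z. ennreal (dP_dQ T f z)"
    by (rule density_subalgebra_ref_measure[OF \<gamma> i])
  have "\<gamma> i \<in> DM_policies T i"
    using \<gamma> i by (auto simp: policies_def)
  \<comment> \<open>The version property is used for the trivial deviation
    \<open>\<beta> = \<gamma> i\<close>.\<close>
  with h have "AE z in ref_measure T Q (\<gamma>(i := \<gamma> i)).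
      nn_cond_exp (ref_measure T Q (\<gamma>(i := \<gamma> i))) (info_algebra i) (\<lambda>z. ennreal (dP_dQ T f z)) z =
      h (\<gamma> i (info T i (snd (snd z))), info T i (snd (snd z)))"
    unfolding cond_exp_version_def by blast
  then have "AE z in ref_measure T Q \<gamma>.
      nn_cond_exp (ref_measure T Q \<gamma>) (info_algebra i) (\<lambda>z. ennreal (dP_dQ T f z)) z =
      h (\<gamma> i (info T i (snd (snd z))), info T i (snd (snd z)))"
    unfolding fun_upd_triv .
  from AE_density_of_AE[OF this] nn_cond_exp_density_nonzero show ?thesis
    unfolding joint_law_eq_density[OF \<gamma>] by eventually_elim simp
qed

lemma stationary_reduction:
  assumes \<gamma>: "\<gamma> \<in> policies T"
    and D: "cond_gradient_zero T (ref_measure T Q) (dP_dQ T f) \<gamma>"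
  shows "stationary T (joint_law T) (team_cost T) \<gamma> \<longleftrightarrow>
    stationary T (ref_measure T Q) (reduced_cost T f) \<gamma>"
proof
  assume P: "stationary T (joint_law T) (team_cost T) \<gamma>"
  show "stationary T (ref_measure T Q) (reduced_cost T f) \<gamma>"
    unfolding stationary_def cond_gradient_zero_def
  proof
    fix i assume i: "i \<in> DMs T"
    obtain h where h: "cond_exp_version T (ref_measure T Q) (dP_dQ T f) \<gamma> i h"
      and h': "AE z in joint_law T \<gamma>. has_gradient_within (\<lambda>u. h (u, info T i (snd (snd z)))) 0
             (\<gamma> i (info T i (snd (snd z)))) (Action T i)"
      using D i unfolding cond_gradient_zero_def by blast
    obtain k where k: "cond_exp_version T (joint_law T) (team_cost T) \<gamma> i k"
      and k': "AE z in joint_law T \<gamma>. has_gradient_within (\<lambda>u. k (u, info T i (snd (snd z)))) 0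
             (\<gamma> i (info T i (snd (snd z)))) (Action T i)"
      using P i unfolding stationary_def cond_gradient_zero_def by blast
    \<comment> \<open>The witness for the reduction is the product of \<open>k\<close> and
      \<open>h\<close>; the exceptional sets of both gradients are null for the same law.\<close>
    have "AE z in joint_law T \<gamma>. has_gradient_within
        (\<lambda>u. k (u, info T i (snd (snd z))) * h (u, info T i (snd (snd z)))) 0
        (\<gamma> i (info T i (snd (snd z)))) (Action T i)"
      using k' h' by eventually_elim (rule has_gradient_within_zero_mult)
    with cond_exp_version_mult[OF \<gamma> i k h]
    show "\<exists>g. cond_exp_version T (ref_measure T Q) (reduced_cost T f) \<gamma> i g \<and>
        (AE z in joint_law T \<gamma>. has_gradient_within (\<lambda>u. g (u, info T i (snd (snd z)))) 0
             (\<gamma> i (info T i (snd (snd z)))) (Action T i))"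
      by blast
  qed
next
  assume R: "stationary T (ref_measure T Q) (reduced_cost T f) \<gamma>"
  show "stationary T (joint_law T) (team_cost T) \<gamma>"
    unfolding stationary_def cond_gradient_zero_def
  proof
    fix i assume i: "i \<in> DMs T"
    obtain h where h: "cond_exp_version T (ref_measure T Q) (dP_dQ T f) \<gamma> i h"
      and h': "AE z in joint_law T \<gamma>. has_gradient_within (\<lambda>u. h (u, info T i (snd (snd z)))) 0
             (\<gamma> i (info T i (snd (snd z)))) (Action T i)"
      using D i unfolding cond_gradient_zero_def by blast
    obtain g where g: "cond_exp_version T (ref_measure T Q) (reduced_cost T f) \<gamma> i g"
      and g': "AE z in joint_law T \<gamma>. has_gradient_within (\<lambda>u. g (u, info T i (snd (snd z)))) 0
             (\<gamma> i (info T i (snd (snd z)))) (Action T i)"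
      using R i unfolding stationary_def cond_gradient_zero_def by blast
    \<comment> \<open>The witness for the original team is \<open>g\<close> times the inverse of
      \<open>h\<close>; its gradient vanishes because \<open>h\<close> has zero gradient and is
      nonzero at the action used.\<close>
    have "AE z in joint_law T \<gamma>. has_gradient_within
        (\<lambda>u. g (u, info T i (snd (snd z))) * inverse (h (u, info T i (snd (snd z))))) 0
        (\<gamma> i (info T i (snd (snd z)))) (Action T i)"
      using g' h' cond_exp_version_dP_dQ_nonzero[OF \<gamma> i h]
      by eventually_elim (intro has_gradient_within_zero_mult has_gradient_within_zero_inverse)
    with cond_exp_version_quotient[OF \<gamma> i g h]
    show "\<exists>g. cond_exp_version T (joint_law T) (team_cost T) \<gamma> i g \<and>
        (AE z in joint_law T \<gamma>. has_gradient_within (\<lambda>u. g (u, info T i (snd (snd z)))) 0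
             (\<gamma> i (info T i (snd (snd z)))) (Action T i))"
      by blast
  qed
qed

end

theorem theorem3p1:
  fixes T :: "('p, 'a::polish_space, 'w, 'u::euclidean_space, 'y::euclidean_space) team"
    and Q :: "nat \<Rightarrow> 'y measure"
    and f :: "nat \<Rightarrow> 'y \<times> ('a, 'u, 'y) history \<Rightarrow> real"
    and \<gamma> :: "('u, 'y) policy"
  assumes "sequential_team T"
    and "abs_continuity T Q f"
    and "\<gamma> \<in> policies T"
  shows "(pbp_optimal T (joint_law T) (team_cost T) \<gamma> \<longleftrightarrow>
            pbp_optimal T (ref_measure T Q) (reduced_cost T f) \<gamma>) \<and>
         (globally_optimal T (joint_law T) (team_cost T) \<gamma> \<longleftrightarrow>
            globally_optimal T (ref_measure T Q) (reduced_cost T f) \<gamma>) \<and>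
         (cond_gradient_zero T (ref_measure T Q) (dP_dQ T f) \<gamma> \<longrightarrow>
            (stationary T (joint_law T) (team_cost T) \<gamma> \<longleftrightarrow>
             stationary T (ref_measure T Q) (reduced_cost T f) \<gamma>))"
proof -
  interpret reducible_team T Q f
    using assms(1,2) by (rule reducible_team.intro)
  show ?thesis
    using assms(3) pbp_optimal_reduction globally_optimal_reduction stationary_reduction by blast
qed

end
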